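(* Let $(\mathcal{M},\phi,\xi,\eta,g)$ be a paracontact almost paracomplex Riemannian manifold of dimension $2n+1$, i.e. an almost paracontact almost paracomplex Riemannian manifold satisfying $2g(x,\phi y)=(\mathfrak{L}_\xi g)(x,y)$ for all $x,y$. Then it belongs to $\mathcal{F}_4'$ or to a direct sum of $\mathcal{F}_4'$ with some of the classes $\mathcal{F}_1,\mathcal{F}_2,\mathcal{F}_3,\mathcal{F}_7,\mathcal{F}_8,\mathcal{F}_{10}$; that is, $$F=F_1+F_2+F_3+F_4'+F_7+F_8+F_{10},\qquad F_4'(x,y,z)=-g(\phi x,\phi y)\eta(z)-g(\phi x,\phi z)\eta(y).$$
   Context: Let $n\ge 1$. An almost paracontact almost paracomplex Riemannian manifold $(\mathcal{M},\phi,\xi,\eta,g)$ is a $(2n+1)$-dimensional smooth manifold with a $(1,1)$-tensor field $\phi$, a vector field $\xi$ and a 1-form $\eta$ such that $\phi\xi=0$, $\phi^2=I-\eta\otimes\xi$, $\eta\circ\phi=0$, $\eta(\xi)=1$, $\mathrm{tr}\,\phi=0$, and a Riemannian metric $g$ with $g(\phi x,\phi y)=g(x,y)-\eta(x)\eta(y)$, $g(x,\xi)=\eta(x)$. With $\nabla$ the Levi-Civita connection of $g$, the fundamental tensor is $F(x,y,z)=g((\nabla_x\phi)y,z)$. $\mathfrak{L}_\xi g$ is the Lie derivative, $(\mathfrak{L}_\xi g)(x,y)=(\nabla_x\eta)y+(\nabla_y\eta)x$. Lee forms: for an orthonormal basis $e_1,\dots,e_{2n}$ of $\ker\eta$ at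 a point, $\theta(z)=\sum_{i=1}^{2n}F(e_i,e_i,z)$, $\theta^*(z)=\sum_{i=1}^{2n}F(e_i,\phi e_i,z)$, $\omega(z)=F(\xi,\xi,z)$. Components of $F$. For a $(0,2)$-tensor $S$ put $[S](x,y,z)=S(x,y)\eta(z)+S(x,z)\eta(y)$; put $b(x,y)=F(\phi^2x,\phi^2y,\xi)$ and $c(x,y)=F(\phi x,\phi y,\xi)$. Then $F_1(x,y,z)=\frac1{2n}\{g(\phi x,\phi y)\theta(\phi^2z)+g(\phi x,\phi z)\theta(\phi^2y)-g(x,\phi y)\theta(\phi z)-g(x,\phi z)\theta(\phi y)\}$; $F_2(x,y,z)=\frac14\{2F(\phi^2x,\phi^2y,\phi^2z)+F(\phi^2y,\phi^2z,\phi^2x)+F(\phi^2z,\phi^2x,\phi^2y)-F(\phi y,\phi z,\phi^2x)-F(\phi z,\phi y,\phi^2x)\}-F_1(x,y,z)$; $F_3(x,y,z)=\frac14\{2F(\phi^2x,\phi^2y,\phi^2z)-F(\phi^2y,\phi^2z,\phi^2x)-F(\phi^2z,\phi^2x,\phi^2y)+F(\phi y,\phi z,\phi^2x)+F(\phi z,\phi y,\phi^2x)\}$; $F_4=\frac{\theta(\xi)}{2n}[S]$ with $S(x,y)=g(\phi x,\phi y)$; $F_5=\frac{\theta^*(\xi)}{2n}[S]$ with $S(x,y)=g(x,\phi y)$; $F_6=\frac14[S]-F_4-F_5$ with $S(x,y)=b(x,y)+b(y,x)+c(x,y)+c(y,x)$; $F_7=\frac14[S]$ with $S(x,y)=b(x,y)-b(y,x)+c(x,y)-c(y,x)$;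 $F_8=\frac14[S]$ with $S(x,y)=b(x,y)+b(y,x)-c(x,y)-c(y,x)$; $F_9=\frac14[S]$ with $S(x,y)=b(x,y)-b(y,x)-c(x,y)+c(y,x)$; $F_{10}(x,y,z)=\eta(x)F(\xi,\phi^2y,\phi^2z)$; $F_{11}(x,y,z)=\eta(x)\{\eta(y)\omega(z)+\eta(z)\omega(y)\}$. The manifold belongs to the class $\mathcal{F}_i$ if $F=F_i$, and to a direct sum $\mathcal{F}_i\oplus\mathcal{F}_j\oplus\cdots$ if $F=F_i+F_j+\cdots$. $\mathcal{F}_4'$ is the subclass of $\mathcal{F}_4$ determined by $\theta(\xi)=-2n$; the corresponding component of $F$ is $F_4'$ (that is, $F_4$ with $\theta(\xi)=-2n$). *)

theory Defs
  imports "HOL-Analysis.Analysis"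
begin

section \<open>Smooth manifolds\<close>

primrec C_k_on :: "nat \<Rightarrow> 'e::real_normed_vector set \<Rightarrow> ('e \<Rightarrow> 'f::real_normed_vector) \<Rightarrow> bool" where
  "C_k_on 0 U f \<longleftrightarrow> continuous_on U f"
| "C_k_on (Suc k) U f \<longleftrightarrow>
     (\<forall>x\<in>U. f differentiable (at x)) \<and> (\<forall>v. C_k_on k U (\<lambda>x. frechet_derivative f (at x) v))"

definition smooth_on :: "'e::real_normed_vector set \<Rightarrow> ('e \<Rightarrow> 'f::real_normed_vector) \<Rightarrow> bool" where
  "smooth_on U f \<longleftrightarrow> (\<forall>k. C_k_on k U f)"

type_synonym ('a, 'e) chart = "'a set \<times> ('a \<Rightarrow> 'e)"

abbreviation cdom :: "('a, 'e) chart \<Rightarrow> 'a set" where "cdom \<equiv> fst"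
abbreviation cmap :: "('a, 'e) chart \<Rightarrow> 'a \<Rightarrow> 'e" where "cmap \<equiv> snd"
abbreviation cinv :: "('a, 'e) chart \<Rightarrow> 'e \<Rightarrow> 'a" where "cinv c \<equiv> inv_into (cdom c) (cmap c)"

definition chart_on :: "'a topology \<Rightarrow> ('a, 'e::euclidean_space) chart \<Rightarrow> bool" where
  "chart_on X c \<longleftrightarrow> openin X (cdom c) \<and> open (cmap c ` cdom c) \<and>
     homeomorphic_map (subtopology X (cdom c)) (top_of_set (cmap c ` cdom c)) (cmap c)"

text \<open>The atlas need not be maximal; none of the notions below changes when it is enlarged by
  compatible charts. The dimension of the manifold is \<open>DIM('e)\<close>.\<close>

definition smooth_manifold :: "'a topology \<Rightarrow> ('a, 'e::euclidean_space) chart set \<Rightarrow> bool" where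
  "smooth_manifold X A \<longleftrightarrow> Hausdorff_space X \<and> second_countable X \<and>
     (\<forall>c\<in>A. chart_on X c) \<and> (\<Union>c\<in>A. cdom c) = topspace X \<and>
     (\<forall>c\<in>A. \<forall>c'\<in>A. smooth_on (cmap c ` (cdom c \<inter> cdom c')) (cmap c' \<circ> cinv c))"


section \<open>Tangent vectors and vector fields\<close>

text \<open>A tangent vector at a point is a family of coordinate vectors, one for each chart
  around the point, that transforms with the differentials of the coordinate changes.
  The type below is the vector space of all families indexed by charts.\<close>

typedef ('a, 'e) tvec = "UNIV :: (('a, 'e) chart \<Rightarrow> 'e) set"
  morphisms coords Tvec ..

instantiation tvec :: (type, real_vector) real_vector
begin

definition zero_tvec :: "('a, 'b) tvec" where "0 = Tvec (\<lambda>c. 0)"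
definition plus_tvec :: "('a, 'b) tvec \<Rightarrow> ('a, 'b) tvec \<Rightarrow> ('a, 'b) tvec" where
  "u + v = Tvec (\<lambda>c. coords u c + coords v c)"
definition minus_tvec :: "('a, 'b) tvec \<Rightarrow> ('a, 'b) tvec \<Rightarrow> ('a, 'b) tvec" where
  "u - v = Tvec (\<lambda>c. coords u c - coords v c)"
definition uminus_tvec :: "('a, 'b) tvec \<Rightarrow> ('a, 'b) tvec" where
  "- u = Tvec (\<lambda>c. - coords u c)"
definition scaleR_tvec :: "real \<Rightarrow> ('a, 'b) tvec \<Rightarrow> ('a, 'b) tvec" where
  "r *\<^sub>R u = Tvec (\<lambda>c. r *\<^sub>R coords u c)"

instance
  by standard
    (simp_all add: zero_tvec_def plus_tvec_def minus_tvec_def uminus_tvec_def scaleR_tvec_def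
      Tvec_inverse coords_inverse scaleR_add_left scaleR_add_right ac_simps)

end

definition tangent_space :: "('a, 'e::euclidean_space) chart set \<Rightarrow> 'a \<Rightarrow> ('a, 'e) tvec set" where
  "tangent_space A p = {v.
     (\<forall>c\<in>A. \<forall>c'\<in>A. p \<in> cdom c \<inter> cdom c' \<longrightarrow>
        coords v c' = frechet_derivative (cmap c' \<circ> cinv c) (at (cmap c p)) (coords v c)) \<and>
     (\<forall>c. \<not> (c \<in> A \<and> p \<in> cdom c) \<longrightarrow> coords v c = 0)}"

definition smooth_function :: "'a topology \<Rightarrow> ('a, 'e::euclidean_space) chart set \<Rightarrow> 'a set \<Rightarrow> ('a \<Rightarrow> real) \<Rightarrow> bool" where
  "smooth_function X A W f \<longleftrightarrow> openin X W \<and>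
     (\<forall>c\<in>A. smooth_on (cmap c ` (cdom c \<inter> W)) (f \<circ> cinv c))"

text \<open>A smooth vector field on the open set \<open>W\<close>; its values outside \<open>W\<close> are irrelevant.\<close>

definition smooth_vfield :: "'a topology \<Rightarrow> ('a, 'e::euclidean_space) chart set \<Rightarrow> 'a set \<Rightarrow> ('a \<Rightarrow> ('a, 'e) tvec) \<Rightarrow> bool" where
  "smooth_vfield X A W Y \<longleftrightarrow> openin X W \<and> (\<forall>p\<in>W. Y p \<in> tangent_space A p) \<and>
     (\<forall>c\<in>A. smooth_on (cmap c ` (cdom c \<inter> W)) (\<lambda>u. coords (Y (cinv c u)) c))"

text \<open>Directional derivative of \<open>f\<close> at \<open>p\<close> along the tangent vector \<open>v\<close>; the result does not
  depend on the chart.\<close>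

definition dir_deriv :: "('a, 'e::euclidean_space) chart set \<Rightarrow> 'a \<Rightarrow> ('a, 'e) tvec \<Rightarrow> ('a \<Rightarrow> real) \<Rightarrow> real" where
  "dir_deriv A p v f =
     (let c = (SOME c. c \<in> A \<and> p \<in> cdom c)
      in frechet_derivative (f \<circ> cinv c) (at (cmap c p)) (coords v c))"

definition lie_bracket :: "('a, 'e::euclidean_space) chart set \<Rightarrow> ('a \<Rightarrow> ('a, 'e) tvec) \<Rightarrow> ('a \<Rightarrow> ('a, 'e) tvec) \<Rightarrow> 'a \<Rightarrow> ('a, 'e) tvec" where
  "lie_bracket A Y Z p = Tvec (\<lambda>c. if c \<in> A \<and> p \<in> cdom c
     then frechet_derivative (\<lambda>u. coords (Z (cinv c u)) c) (at (cmap c p)) (coords (Y p) c)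
        - frechet_derivative (\<lambda>u. coords (Y (cinv c u)) c) (at (cmap c p)) (coords (Z p) c)
     else 0)"

text \<open>Some smooth vector field defined near \<open>p\<close> with value \<open>y\<close> at \<open>p\<close>. It is only used in
  expressions that are tensorial, so that the choice of the extension is immaterial.\<close>

definition vf_extension :: "'a topology \<Rightarrow> ('a, 'e::euclidean_space) chart set \<Rightarrow> 'a \<Rightarrow> ('a, 'e) tvec \<Rightarrow> 'a \<Rightarrow> ('a, 'e) tvec" where
  "vf_extension X A p y = (SOME Y. (\<exists>W. p \<in> W \<and> smooth_vfield X A W Y) \<and> Y p = y)"


section \<open>Tensor fields, Riemannian metrics and the Levi-Civita connection\<close>

definition lin_on :: "'v::real_vector set \<Rightarrow> ('v \<Rightarrow> 'w::real_vector) \<Rightarrow> bool" where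
  "lin_on V f \<longleftrightarrow> (\<forall>u\<in>V. \<forall>v\<in>V. f (u + v) = f u + f v) \<and> (\<forall>r. \<forall>u\<in>V. f (r *\<^sub>R u) = r *\<^sub>R f u)"

text \<open>Trace of an endomorphism \<open>f\<close> of the finite-dimensional subspace \<open>V\<close>.\<close>

definition trace_on :: "'v::real_vector set \<Rightarrow> ('v \<Rightarrow> 'v) \<Rightarrow> real" where
  "trace_on V f = (let B = (SOME B. independent B \<and> span B = V) in \<Sum>b\<in>B. representation B (f b) b)"

definition one_form :: "'a topology \<Rightarrow> ('a, 'e::euclidean_space) chart set \<Rightarrow> ('a \<Rightarrow> ('a, 'e) tvec \<Rightarrow> real) \<Rightarrow> bool" where
  "one_form X A \<alpha> \<longleftrightarrow>
     (\<forall>p\<in>topspace X. lin_on (tangent_space A p) (\<alpha> p)) \<and>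
     (\<forall>W Y. smooth_vfield X A W Y \<longrightarrow> smooth_function X A W (\<lambda>p. \<alpha> p (Y p)))"

definition tensor_1_1 :: "'a topology \<Rightarrow> ('a, 'e::euclidean_space) chart set \<Rightarrow> ('a \<Rightarrow> ('a, 'e) tvec \<Rightarrow> ('a, 'e) tvec) \<Rightarrow> bool" where
  "tensor_1_1 X A T \<longleftrightarrow>
     (\<forall>p\<in>topspace X. lin_on (tangent_space A p) (T p) \<and> T p ` tangent_space A p \<subseteq> tangent_space A p) \<and>
     (\<forall>W Y. smooth_vfield X A W Y \<longrightarrow> smooth_vfield X A W (\<lambda>p. T p (Y p)))"

definition tensor_0_2 :: "'a topology \<Rightarrow> ('a, 'e::euclidean_space) chart set \<Rightarrow> ('a \<Rightarrow> ('a, 'e) tvec \<Rightarrow> ('a, 'e) tvec \<Rightarrow> real) \<Rightarrow> bool" where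
  "tensor_0_2 X A T \<longleftrightarrow>
     (\<forall>p\<in>topspace X. \<forall>x\<in>tangent_space A p.
        lin_on (tangent_space A p) (\<lambda>y. T p x y) \<and> lin_on (tangent_space A p) (\<lambda>y. T p y x)) \<and>
     (\<forall>W Y Z. smooth_vfield X A W Y \<longrightarrow> smooth_vfield X A W Z \<longrightarrow>
        smooth_function X A W (\<lambda>p. T p (Y p) (Z p)))"

definition riemannian_metric :: "'a topology \<Rightarrow> ('a, 'e::euclidean_space) chart set \<Rightarrow> ('a \<Rightarrow> ('a, 'e) tvec \<Rightarrow> ('a, 'e) tvec \<Rightarrow> real) \<Rightarrow> bool" where
  "riemannian_metric X A g \<longleftrightarrow> tensor_0_2 X A g \<and>
     (\<forall>p\<in>topspace X. \<forall>x\<in>tangent_space A p. \<forall>y\<in>tangent_space A p. g p x y = g p y x) \<and>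
     (\<forall>p\<in>topspace X. \<forall>x\<in>tangent_space A p. x \<noteq> 0 \<longrightarrow> g p x x > 0)"

text \<open>\<open>nabla p v Y\<close> is the covariant derivative at \<open>p\<close> of the vector field \<open>Y\<close> in the direction of
  the tangent vector \<open>v\<close>. As usual, a connection acts on vector fields defined on arbitrary
  open subsets.\<close>

type_synonym ('a, 'e) connection = "'a \<Rightarrow> ('a, 'e) tvec \<Rightarrow> ('a \<Rightarrow> ('a, 'e) tvec) \<Rightarrow> ('a, 'e) tvec"

definition affine_connection :: "'a topology \<Rightarrow> ('a, 'e::euclidean_space) chart set \<Rightarrow> ('a, 'e) connection \<Rightarrow> bool" where
  "affine_connection X A nabla \<longleftrightarrow>
     (\<forall>W Y. smooth_vfield X A W Y \<longrightarrow> (\<forall>p\<in>W.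
        lin_on (tangent_space A p) (\<lambda>v. nabla p v Y) \<and>
        (\<forall>v\<in>tangent_space A p. nabla p v Y \<in> tangent_space A p))) \<and>
     (\<forall>W Y Z. smooth_vfield X A W Y \<longrightarrow> smooth_vfield X A W Z \<longrightarrow>
        (\<forall>p\<in>W. \<forall>v\<in>tangent_space A p.
           nabla p v (\<lambda>q. Y q + Z q) = nabla p v Y + nabla p v Z)) \<and>
     (\<forall>W f Y. smooth_function X A W f \<longrightarrow> smooth_vfield X A W Y \<longrightarrow>
        (\<forall>p\<in>W. \<forall>v\<in>tangent_space A p.
           nabla p v (\<lambda>q. f q *\<^sub>R Y q) = dir_deriv A p v f *\<^sub>R Y p + f p *\<^sub>R nabla p v Y)) \<and>
     (\<forall>W Y Z. smooth_vfield X A W Y \<longrightarrow> smooth_vfield X A W Z \<longrightarrow>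
        smooth_vfield X A W (\<lambda>p. nabla p (Y p) Z))"

definition levi_civita_connection :: "'a topology \<Rightarrow> ('a, 'e::euclidean_space) chart set \<Rightarrow>
    ('a \<Rightarrow> ('a, 'e) tvec \<Rightarrow> ('a, 'e) tvec \<Rightarrow> real) \<Rightarrow> ('a, 'e) connection \<Rightarrow> bool" where
  "levi_civita_connection X A g nabla \<longleftrightarrow> affine_connection X A nabla \<and>
     (\<forall>W Y Z. smooth_vfield X A W Y \<longrightarrow> smooth_vfield X A W Z \<longrightarrow> (\<forall>p\<in>W.
        nabla p (Y p) Z - nabla p (Z p) Y = lie_bracket A Y Z p)) \<and>
     (\<forall>W Y Z. smooth_vfield X A W Y \<longrightarrow> smooth_vfield X A W Z \<longrightarrow>
        (\<forall>p\<in>W. \<forall>v\<in>tangent_space A p.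
           dir_deriv A p v (\<lambda>q. g q (Y q) (Z q)) = g p (nabla p v Y) (Z p) + g p (Y p) (nabla p v Z)))"


section \<open>Almost paracontact almost paracomplex Riemannian manifolds\<close>

record ('a, 'e) apcr =
  mtop :: "'a topology"
  atlas :: "('a, 'e) chart set"
  phi :: "'a \<Rightarrow> ('a, 'e) tvec \<Rightarrow> ('a, 'e) tvec"
  xi :: "'a \<Rightarrow> ('a, 'e) tvec"
  eta :: "'a \<Rightarrow> ('a, 'e) tvec \<Rightarrow> real"
  metric :: "'a \<Rightarrow> ('a, 'e) tvec \<Rightarrow> ('a, 'e) tvec \<Rightarrow> real"

abbreviation points :: "('a, 'e::euclidean_space) apcr \<Rightarrow> 'a set" where
  "points M \<equiv> topspace (mtop M)"
abbreviation tspace :: "('a, 'e::euclidean_space) apcr \<Rightarrow> 'a \<Rightarrow> ('a, 'e) tvec set" where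
  "tspace M p \<equiv> tangent_space (atlas M) p"

definition almost_paracontact_almost_paracomplex_riemannian ::
    "nat \<Rightarrow> ('a, 'e::euclidean_space) apcr \<Rightarrow> bool" where
  "almost_paracontact_almost_paracomplex_riemannian n M \<longleftrightarrow>
     smooth_manifold (mtop M) (atlas M) \<and> DIM('e) = 2 * n + 1 \<and>
     tensor_1_1 (mtop M) (atlas M) (phi M) \<and>
     smooth_vfield (mtop M) (atlas M) (points M) (xi M) \<and>
     one_form (mtop M) (atlas M) (eta M) \<and>
     riemannian_metric (mtop M) (atlas M) (metric M) \<and>
     (\<forall>p\<in>points M.
        phi M p (xi M p) = 0 \<and>
        (\<forall>x\<in>tspace M p. phi M p (phi M p x) = x - eta M p x *\<^sub>R xi M p) \<and>
        (\<forall>x\<in>tspace M p. eta M p (phi M p x) = 0) \<and>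
        eta M p (xi M p) = 1 \<and>
        trace_on (tspace M p) (phi M p) = 0 \<and>
        (\<forall>x\<in>tspace M p. \<forall>y\<in>tspace M p.
           metric M p (phi M p x) (phi M p y) = metric M p x y - eta M p x * eta M p y) \<and>
        (\<forall>x\<in>tspace M p. metric M p x (xi M p) = eta M p x))"

text \<open>\<open>(L\<^sub>\<xi> g)(X, Y) = \<xi>(g(X, Y)) - g([\<xi>, X], Y) - g(X, [\<xi>, Y])\<close>, evaluated on tangent vectors.
  With the Levi-Civita connection this equals \<open>(\<nabla>\<^sub>x \<eta>) y + (\<nabla>\<^sub>y \<eta>) x\<close>.\<close>

definition lie_deriv_metric :: "('a, 'e::euclidean_space) apcr \<Rightarrow> 'a \<Rightarrow> ('a, 'e) tvec \<Rightarrow> ('a, 'e) tvec \<Rightarrow> real" where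
  "lie_deriv_metric M p x y =
     (let X = vf_extension (mtop M) (atlas M) p x; Y = vf_extension (mtop M) (atlas M) p y in
        dir_deriv (atlas M) p (xi M p) (\<lambda>q. metric M q (X q) (Y q))
        - metric M p (lie_bracket (atlas M) (xi M) X p) y
        - metric M p x (lie_bracket (atlas M) (xi M) Y p))"

definition paracontact_almost_paracomplex_riemannian :: "nat \<Rightarrow> ('a, 'e::euclidean_space) apcr \<Rightarrow> bool" where
  "paracontact_almost_paracomplex_riemannian n M \<longleftrightarrow>
     almost_paracontact_almost_paracomplex_riemannian n M \<and>
     (\<forall>p\<in>points M. \<forall>x\<in>tspace M p. \<forall>y\<in>tspace M p.
        2 * metric M p x (phi M p y) = lie_deriv_metric M p x y)"

text \<open>\<open>(\<nabla>\<^sub>x \<phi>) y = \<nabla>\<^sub>x (\<phi> Y) - \<phi> (\<nabla>\<^sub>x Y)\<close> for a vector field \<open>Y\<close> extending \<open>y\<close>.\<close>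

definition nabla_phi :: "('a, 'e::euclidean_space) apcr \<Rightarrow> ('a, 'e) connection \<Rightarrow> 'a \<Rightarrow> ('a, 'e) tvec \<Rightarrow> ('a, 'e) tvec \<Rightarrow> ('a, 'e) tvec" where
  "nabla_phi M nabla p x y =
     (let Y = vf_extension (mtop M) (atlas M) p y in
        nabla p x (\<lambda>q. phi M q (Y q)) - phi M p (nabla p x Y))"

definition fund_tensor :: "('a, 'e::euclidean_space) apcr \<Rightarrow> ('a, 'e) connection \<Rightarrow> 'a \<Rightarrow>
    ('a, 'e) tvec \<Rightarrow> ('a, 'e) tvec \<Rightarrow> ('a, 'e) tvec \<Rightarrow> real" where
  "fund_tensor M nabla p x y z = metric M p (nabla_phi M nabla p x y) z"

definition ker_eta :: "('a, 'e::euclidean_space) apcr \<Rightarrow> 'a \<Rightarrow> ('a, 'e) tvec set" where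
  "ker_eta M p = {x \<in> tspace M p. eta M p x = 0}"

definition orthonormal_basis :: "('v::real_vector \<Rightarrow> 'v \<Rightarrow> real) \<Rightarrow> 'v set \<Rightarrow> 'v set \<Rightarrow> bool" where
  "orthonormal_basis h V B \<longleftrightarrow> independent B \<and> span B = V \<and>
     (\<forall>u\<in>B. \<forall>v\<in>B. h u v = (if u = v then 1 else 0))"

text \<open>The Lee forms do not depend on the orthonormal basis.\<close>

definition ker_eta_basis :: "('a, 'e::euclidean_space) apcr \<Rightarrow> 'a \<Rightarrow> ('a, 'e) tvec set" where
  "ker_eta_basis M p = (SOME B. orthonormal_basis (metric M p) (ker_eta M p) B)"

definition lee_theta :: "('a, 'e::euclidean_space) apcr \<Rightarrow> ('a, 'e) connection \<Rightarrow> 'a \<Rightarrow> ('a, 'e) tvec \<Rightarrow> real" where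
  "lee_theta M nabla p z = (\<Sum>e\<in>ker_eta_basis M p. fund_tensor M nabla p e e z)"

definition lee_theta_star :: "('a, 'e::euclidean_space) apcr \<Rightarrow> ('a, 'e) connection \<Rightarrow> 'a \<Rightarrow> ('a, 'e) tvec \<Rightarrow> real" where
  "lee_theta_star M nabla p z = (\<Sum>e\<in>ker_eta_basis M p. fund_tensor M nabla p e (phi M p e) z)"

definition lee_omega :: "('a, 'e::euclidean_space) apcr \<Rightarrow> ('a, 'e) connection \<Rightarrow> 'a \<Rightarrow> ('a, 'e) tvec \<Rightarrow> real" where
  "lee_omega M nabla p z = fund_tensor M nabla p (xi M p) (xi M p) z"


section \<open>The components of the fundamental tensor\<close>

definition eta_sym :: "('a, 'e::euclidean_space) apcr \<Rightarrow> 'a \<Rightarrow> (('a, 'e) tvec \<Rightarrow> ('a, 'e) tvec \<Rightarrow> real) \<Rightarrow>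
    ('a, 'e) tvec \<Rightarrow> ('a, 'e) tvec \<Rightarrow> ('a, 'e) tvec \<Rightarrow> real" where
  "eta_sym M p S x y z = S x y * eta M p z + S x z * eta M p y"

definition b_form :: "('a, 'e::euclidean_space) apcr \<Rightarrow> ('a, 'e) connection \<Rightarrow> 'a \<Rightarrow> ('a, 'e) tvec \<Rightarrow> ('a, 'e) tvec \<Rightarrow> real" where
  "b_form M nabla p x y =
     fund_tensor M nabla p (phi M p (phi M p x)) (phi M p (phi M p y)) (xi M p)"

definition c_form :: "('a, 'e::euclidean_space) apcr \<Rightarrow> ('a, 'e) connection \<Rightarrow> 'a \<Rightarrow> ('a, 'e) tvec \<Rightarrow> ('a, 'e) tvec \<Rightarrow> real" where
  "c_form M nabla p x y = fund_tensor M nabla p (phi M p x) (phi M p y) (xi M p)"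

type_synonym ('a, 'e) component =
  "('a, 'e) apcr \<Rightarrow> ('a, 'e) connection \<Rightarrow> nat \<Rightarrow> 'a \<Rightarrow> ('a, 'e) tvec \<Rightarrow> ('a, 'e) tvec \<Rightarrow> ('a, 'e) tvec \<Rightarrow> real"

definition F1 :: "('a, 'e::euclidean_space) component" where
  "F1 M nabla n p x y z =
     (let g = metric M p; f = phi M p; \<theta> = lee_theta M nabla p in
      1 / (2 * real n) *
        (g (f x) (f y) * \<theta> (f (f z)) + g (f x) (f z) * \<theta> (f (f y))
         - g x (f y) * \<theta> (f z) - g x (f z) * \<theta> (f y)))"

definition F2 :: "('a, 'e::euclidean_space) component" where
  "F2 M nabla n p x y z =
     (let F = fund_tensor M nabla p; f = phi M p in
      1 / 4 * (2 * F (f (f x)) (f (f y)) (f (f z))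
        + F (f (f y)) (f (f z)) (f (f x)) + F (f (f z)) (f (f x)) (f (f y))
        - F (f y) (f z) (f (f x)) - F (f z) (f y) (f (f x))))
     - F1 M nabla n p x y z"

definition F3 :: "('a, 'e::euclidean_space) component" where
  "F3 M nabla n p x y z =
     (let F = fund_tensor M nabla p; f = phi M p in
      1 / 4 * (2 * F (f (f x)) (f (f y)) (f (f z))
        - F (f (f y)) (f (f z)) (f (f x)) - F (f (f z)) (f (f x)) (f (f y))
        + F (f y) (f z) (f (f x)) + F (f z) (f y) (f (f x))))"

definition F4 :: "('a, 'e::euclidean_space) component" where
  "F4 M nabla n p x y z = lee_theta M nabla p (xi M p) / (2 * real n) *
     eta_sym M p (\<lambda>x y. metric M p (phi M p x) (phi M p y)) x y z"

definition F5 :: "('a, 'e::euclidean_space) component" where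
  "F5 M nabla n p x y z = lee_theta_star M nabla p (xi M p) / (2 * real n) *
     eta_sym M p (\<lambda>x y. metric M p x (phi M p y)) x y z"

definition F6 :: "('a, 'e::euclidean_space) component" where
  "F6 M nabla n p x y z =
     (let b = b_form M nabla p; c = c_form M nabla p in
      1 / 4 * eta_sym M p (\<lambda>x y. b x y + b y x + c x y + c y x) x y z)
     - F4 M nabla n p x y z - F5 M nabla n p x y z"

definition F7 :: "('a, 'e::euclidean_space) component" where
  "F7 M nabla n p x y z =
     (let b = b_form M nabla p; c = c_form M nabla p in
      1 / 4 * eta_sym M p (\<lambda>x y. b x y - b y x + c x y - c y x) x y z)"

definition F8 :: "('a, 'e::euclidean_space) component" where
  "F8 M nabla n p x y z =
     (let b = b_form M nabla p; c = c_form M nabla p in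
      1 / 4 * eta_sym M p (\<lambda>x y. b x y + b y x - c x y - c y x) x y z)"

definition F9 :: "('a, 'e::euclidean_space) component" where
  "F9 M nabla n p x y z =
     (let b = b_form M nabla p; c = c_form M nabla p in
      1 / 4 * eta_sym M p (\<lambda>x y. b x y - b y x - c x y + c y x) x y z)"

definition F10 :: "('a, 'e::euclidean_space) component" where
  "F10 M nabla n p x y z =
     eta M p x * fund_tensor M nabla p (xi M p) (phi M p (phi M p y)) (phi M p (phi M p z))"

definition F11 :: "('a, 'e::euclidean_space) component" where
  "F11 M nabla n p x y z =
     eta M p x * (eta M p y * lee_omega M nabla p z + eta M p z * lee_omega M nabla p y)"

text \<open>\<open>F4\<close> with \<open>\<theta>(\<xi>)\<close> replaced by \<open>- 2 n\<close>.\<close>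

definition F4' :: "('a, 'e::euclidean_space) component" where
  "F4' M nabla n p x y z = (- 2 * real n) / (2 * real n) *
     eta_sym M p (\<lambda>x y. metric M p (phi M p x) (phi M p y)) x y z"

text \<open>The components \<open>F\<^sub>1, \<dots>, F\<^sub>1\<^sub>1\<close> as an indexed family.\<close>

definition F_comp :: "nat \<Rightarrow> ('a, 'e::euclidean_space) component" where
  "F_comp i = [F1, F2, F3, F4, F5, F6, F7, F8, F9, F10, F11] ! (i - 1)"

text \<open>Membership in the direct sum of the classes with indices in \<open>I\<close> (for \<open>I = {i}\<close>: in the
  class with index \<open>i\<close> itself).\<close>

definition in_class_sum :: "nat set \<Rightarrow> ('a, 'e::euclidean_space) apcr \<Rightarrow> ('a, 'e) connection \<Rightarrow> nat \<Rightarrow> bool" where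
  "in_class_sum I M nabla n \<longleftrightarrow>
     (\<forall>p\<in>points M. \<forall>x\<in>tspace M p. \<forall>y\<in>tspace M p. \<forall>z\<in>tspace M p.
        fund_tensor M nabla p x y z = (\<Sum>i\<in>I. F_comp i M nabla n p x y z))"

text \<open>Membership in the direct sum of the subclass of \<open>F\<^sub>4\<close> given by \<open>\<theta>(\<xi>) = - 2 n\<close> with the
  classes whose indices are in \<open>I\<close>, where \<open>4 \<notin> I\<close>.\<close>

definition in_F4'_sum :: "nat set \<Rightarrow> ('a, 'e::euclidean_space) apcr \<Rightarrow> ('a, 'e) connection \<Rightarrow> nat \<Rightarrow> bool" where
  "in_F4'_sum I M nabla n \<longleftrightarrow> in_class_sum (insert 4 I) M nabla n \<and>
     (\<forall>p\<in>points M. lee_theta M nabla p (xi M p) = - 2 * real n)"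

end

theory Submission
  imports Defs
begin

text \<open>The tensor \<open>F\<close> is governed by two identities, each obtained by differentiating a pointwise
  identity with a connection compatible with \<open>g\<close>. Since \<open>\<phi>\<close> is self-adjoint, \<open>F\<close> is symmetric in its last
  two arguments (\<open>fund_tensor_sym\<close>), and since \<open>g (\<phi> Z) \<xi> = 0\<close>, its part along \<open>\<xi>\<close> is
  \<open>F(x, z, \<xi>) = - (\<nabla>\<^sub>x \<eta>)(\<phi> z)\<close> (\<open>fund_tensor_xi\<close>). The connection being torsion-free and metric,
  the Lie derivative of \<open>g\<close> along \<open>\<xi>\<close> is twice the symmetric part of \<open>\<nabla>\<eta>\<close>, so the paracontact condition
  says that this symmetric part is \<open>g x (\<phi> y)\<close>.

  Three consequences carry the proof. First, \<open>\<nabla>\<^sub>\<xi> \<eta> = 0\<close>, which kills \<open>F\<^sub>1\<^sub>1\<close>; splitting each argument of \<open>F\<close>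
  into its horizontal part and its \<open>\<xi>\<close>-part then leaves the purely horizontal part \<open>F\<^sub>1 + F\<^sub>2 + F\<^sub>3\<close>, the
  part \<open>F\<^sub>1\<^sub>0\<close> and the mixed part \<open>[b]\<close> (\<open>fund_tensor_decomposition\<close>). Secondly,
  \<open>b(x, y) + c(y, x) = - 2 g (\<phi> x) (\<phi> y)\<close>, by which \<open>[b]\<close> equals \<open>F\<^sub>4' + F\<^sub>7 + F\<^sub>8\<close>
  (\<open>mixed_components\<close>). Thirdly, \<open>\<theta>(\<xi>)\<close> is minus the trace over the horizontal space of
  \<open>(x, y) \<mapsto> (\<nabla>\<^sub>x \<eta>)(\<phi> y)\<close>. As \<open>\<phi>\<close> is self-adjoint, only the symmetric part of \<open>\<nabla>\<eta>\<close> contributes, and as \<open>\<phi>\<close> is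
  a horizontal isometry, the trace is the dimension \<open>2 n\<close> of the horizontal space (\<open>lee_theta_xi\<close>).

  Two foundations support this. The definitions of \<open>F\<close> and of the Lie derivative evaluate
  vector fields that extend given tangent vectors, so such extensions have to exist: a field
  with constant coordinates in one chart will do, and its smoothness in all the other charts
  rests on the composition of smooth maps. The Lee form refers to an orthonormal basis of
  the horizontal space, whose existence is Gram-Schmidt and whose size comes from the
  description of the horizontal space in a chart as a hyperplane.\<close>

section \<open>Calculus of smooth maps between normed spaces\<close>

text \<open>Functions that agree near a point have the same derivatives there, possibly none, so the
  choice operator in \<open>frechet_derivative\<close> picks the same value for both.\<close>

lemma frechet_derivative_cong_open:
  assumes "open U" "x \<in> U" "\<And>y. y \<in> U \<Longrightarrow> f y = g y"
  shows "frechet_derivative f (at x) = frechet_derivative g (at x)"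
proof -
  have "(f has_derivative D) (at x) \<longleftrightarrow> (g has_derivative D) (at x)" for D
    using has_derivative_transform_within_open[of f D x UNIV U g]
      has_derivative_transform_within_open[of g D x UNIV U f] assms by auto
  then show ?thesis
    by (simp add: frechet_derivative_def)
qed

lemma C_k_on_subset: "C_k_on k U f \<Longrightarrow> V \<subseteq> U \<Longrightarrow> C_k_on k V f"
  by (induction k arbitrary: f) (auto intro: continuous_on_subset)

lemma C_k_on_SucD: "C_k_on (Suc k) U f \<Longrightarrow> C_k_on k U f"
proof (induction k arbitrary: f)
  case 0
  then show ?case
    by (auto intro!: continuous_at_imp_continuous_on differentiable_imp_continuous_within)
next
  case (Suc k)
  have "C_k_on k U (\<lambda>x. frechet_derivative f (at x) v)" for v
    using Suc.prems by (intro Suc.IH) (simp only: C_k_on.simps(2)[of "Suc k" U f])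
  then show ?case
    using Suc.prems by simp
qed

lemma C_k_on_cong:
  assumes "open U" "\<And>x. x \<in> U \<Longrightarrow> f x = g x"
  shows "C_k_on k U f \<longleftrightarrow> C_k_on k U g"
  using assms(2)
proof (induction k arbitrary: f g)
  case 0
  then show ?case by (simp cong: continuous_on_cong)
next
  case (Suc k)
  have "f differentiable (at x) \<longleftrightarrow> g differentiable (at x)" if "x \<in> U" for x
    unfolding differentiable_def
    using has_derivative_transform_within_open[of f _ x UNIV U g]
      has_derivative_transform_within_open[of g _ x UNIV U f] assms(1) that Suc.prems by auto
  moreover have "C_k_on k U (\<lambda>x. frechet_derivative f (at x) v) \<longleftrightarrow>
      C_k_on k U (\<lambda>x. frechet_derivative g (at x) v)" for v
    by (rule Suc.IH) (metis frechet_derivative_cong_open[OF assms(1)] Suc.prems)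
  ultimately show ?case by simp
qed

lemma C_k_on_const: "C_k_on k U (\<lambda>x. c)"
  by (induction k arbitrary: c) auto

lemma C_k_on_add:
  assumes "open U" "C_k_on k U f" "C_k_on k U g"
  shows "C_k_on k U (\<lambda>x. f x + g x)"
  using assms(2,3)
proof (induction k arbitrary: f g)
  case 0
  then show ?case by (simp add: continuous_on_add)
next
  case (Suc k)
  have D: "frechet_derivative (\<lambda>x. f x + g x) (at x) v =
      frechet_derivative f (at x) v + frechet_derivative g (at x) v" if "x \<in> U" for x v
  proof -
    have "((\<lambda>x. f x + g x) has_derivative
        (\<lambda>v. frechet_derivative f (at x) v + frechet_derivative g (at x) v)) (at x)"
      using Suc.prems that by (intro has_derivative_add) (auto simp: frechet_derivative_works)
    then show ?thesis by (metis frechet_derivative_at)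
  qed
  have "C_k_on k U (\<lambda>x. frechet_derivative (\<lambda>x. f x + g x) (at x) v)" for v
    using Suc.prems by (subst C_k_on_cong[OF assms(1) D]) (auto intro!: Suc.IH)
  then show ?case
    using Suc.prems by (auto intro!: differentiable_add)
qed

lemma C_k_on_sum:
  assumes "open U" "finite I" "\<And>i. i \<in> I \<Longrightarrow> C_k_on k U (f i)"
  shows "C_k_on k U (\<lambda>x. \<Sum>i\<in>I. f i x)"
  using assms(2,3) by (induction I rule: finite_induct) (simp_all add: C_k_on_const C_k_on_add assms(1))

lemma C_k_on_scaleR:
  assumes "open U" "C_k_on k U r" "C_k_on k U f"
  shows "C_k_on k U (\<lambda>x. r x *\<^sub>R f x)"
  using assms(2,3)
proof (induction k arbitrary: r f)
  case 0
  then show ?case by (simp add: continuous_on_scaleR)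
next
  case (Suc k)
  have D: "((\<lambda>x. r x *\<^sub>R f x) has_derivative
      (\<lambda>v. r x *\<^sub>R frechet_derivative f (at x) v + frechet_derivative r (at x) v *\<^sub>R f x)) (at x)"
    if "x \<in> U" for x
    using Suc.prems that by (intro has_derivative_scaleR) (auto simp: frechet_derivative_works)
  have D': "frechet_derivative (\<lambda>x. r x *\<^sub>R f x) (at x) v =
      r x *\<^sub>R frechet_derivative f (at x) v + frechet_derivative r (at x) v *\<^sub>R f x"
    if "x \<in> U" for x v
    by (metis frechet_derivative_at[OF D[OF that]])
  have "C_k_on k U (\<lambda>x. frechet_derivative (\<lambda>x. r x *\<^sub>R f x) (at x) v)" for v
    using Suc.prems C_k_on_SucD[OF Suc.prems(1)] C_k_on_SucD[OF Suc.prems(2)]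
    by (subst C_k_on_cong[OF assms(1) D']) (auto intro!: Suc.IH C_k_on_add assms(1))
  then show ?case
    using D by (auto simp: differentiable_def)
qed

lemma C_k_on_inner_left:
  assumes "open U" "C_k_on k U f"
  shows "C_k_on k U (\<lambda>x. f x \<bullet> b)"
  using assms(2)
proof (induction k arbitrary: f)
  case 0
  then show ?case by (simp add: continuous_on_inner)
next
  case (Suc k)
  have D: "((\<lambda>x. f x \<bullet> b) has_derivative (\<lambda>v. frechet_derivative f (at x) v \<bullet> b)) (at x)"
    if "x \<in> U" for x
    using Suc.prems that by (intro has_derivative_inner_left) (auto simp: frechet_derivative_works)
  have D': "frechet_derivative (\<lambda>x. f x \<bullet> b) (at x) v = frechet_derivative f (at x) v \<bullet> b"
    if "x \<in> U" for x v
    by (metis frechet_derivative_at[OF D[OF that]])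
  have "C_k_on k U (\<lambda>x. frechet_derivative (\<lambda>x. f x \<bullet> b) (at x) v)" for v
    using Suc.prems by (subst C_k_on_cong[OF assms(1) D']) (auto intro!: Suc.IH)
  then show ?case
    using D by (auto simp: differentiable_def)
qed

text \<open>By the chain rule the derivative of \<open>g \<circ> f\<close> along \<open>v\<close> is the sum, over the standard basis
  vectors \<open>b\<close>, of the \<open>b\<close>-component of the derivative of \<open>f\<close> times the derivative of \<open>g\<close> along \<open>b\<close>,
  composed with \<open>f\<close>. Each summand is a product of functions that are covered by the induction
  hypothesis.\<close>

lemma C_k_on_compose:
  fixes f :: "'a::real_normed_vector \<Rightarrow> 'b::euclidean_space"
    and g :: "'b \<Rightarrow> 'c::real_normed_vector"
  assumes "open U" "f ` U \<subseteq> V" "C_k_on k U f" "C_k_on k V g"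
  shows "C_k_on k U (\<lambda>x. g (f x))"
  using assms(3,4)
proof (induction k arbitrary: g)
  case 0
  then show ?case
    using assms(2) by (auto intro: continuous_on_compose2)
next
  case (Suc k)
  let ?S = "\<lambda>x v. \<Sum>b\<in>Basis. (frechet_derivative f (at x) v \<bullet> b) *\<^sub>R frechet_derivative g (at (f x)) b"
  have diff: "f differentiable (at x)" "g differentiable (at (f x))" if "x \<in> U" for x
    using Suc.prems assms(2) that by auto
  have D: "frechet_derivative (\<lambda>x. g (f x)) (at x) v = ?S x v" if "x \<in> U" for x v
  proof -
    have lin: "linear (frechet_derivative g (at (f x)))"
      by (rule linear_frechet_derivative[OF diff(2)[OF that]])
    have "frechet_derivative (\<lambda>x. g (f x)) (at x) v =
        frechet_derivative g (at (f x)) (frechet_derivative f (at x) v)"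
      using frechet_derivative_compose[OF diff[OF that]] by (simp add: o_def)
    also have "\<dots> = frechet_derivative g (at (f x))
        (\<Sum>b\<in>Basis. (frechet_derivative f (at x) v \<bullet> b) *\<^sub>R b)"
      by (simp add: euclidean_representation)
    also have "\<dots> = ?S x v"
      by (simp add: linear_sum[OF lin] linear_scale[OF lin])
    finally show ?thesis .
  qed
  have "C_k_on k U (\<lambda>x. ?S x v)" for v
    using Suc.prems C_k_on_SucD[OF Suc.prems(1)]
    by (intro C_k_on_sum C_k_on_scaleR C_k_on_inner_left Suc.IH assms(1)) auto
  then have "C_k_on k U (\<lambda>x. frechet_derivative (\<lambda>x. g (f x)) (at x) v)" for v
    by (subst C_k_on_cong[OF assms(1) D]) auto
  moreover have "(\<lambda>x. g (f x)) differentiable (at x)" if "x \<in> U" for x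
    using differentiable_chain_at[OF diff[OF that]] by (simp add: o_def)
  ultimately show ?case by simp
qed

lemma smooth_on_subset: "smooth_on U f \<Longrightarrow> V \<subseteq> U \<Longrightarrow> smooth_on V f"
  unfolding smooth_on_def using C_k_on_subset by blast

lemma smooth_on_differentiable: "smooth_on U f \<Longrightarrow> x \<in> U \<Longrightarrow> f differentiable (at x)"
  unfolding smooth_on_def by (metis C_k_on.simps(2))

lemma smooth_on_derivative: "smooth_on U f \<Longrightarrow> smooth_on U (\<lambda>x. frechet_derivative f (at x) v)"
  unfolding smooth_on_def by (metis C_k_on.simps(2))


section \<open>Charts, tangent spaces and extensions of tangent vectors\<close>

lemma coords_simps [simp]:
  "coords 0 c = 0" "coords (u + v) c = coords u c + coords v c" "coords (r *\<^sub>R u) c = r *\<^sub>R coords u c"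
  by (simp_all add: zero_tvec_def plus_tvec_def scaleR_tvec_def Tvec_inverse)

lemma tvec_eqI: "(\<And>c. coords u c = coords v c) \<Longrightarrow> u = v"
  by (metis coords_inverse ext)

locale smooth_mfd =
  fixes X :: "'a topology" and A :: "('a, 'e::euclidean_space) chart set"
  assumes smooth_manifold: "smooth_manifold X A"
begin

lemma openin_cdom: "c \<in> A \<Longrightarrow> openin X (cdom c)"
  using smooth_manifold by (auto simp: smooth_manifold_def chart_on_def)

lemma chart_around:
  assumes "p \<in> topspace X"
  obtains c where "c \<in> A" "p \<in> cdom c"
proof -
  have "p \<in> (\<Union>c\<in>A. cdom c)"
    using smooth_manifold assms by (simp add: smooth_manifold_def)
  then show ?thesis
    using that by blast
qed

lemma inj_on_chart:
  assumes "c \<in> A"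
  shows "inj_on (cmap c) (cdom c)"
proof -
  have "cdom c \<subseteq> topspace X"
    by (rule openin_subset[OF openin_cdom[OF assms]])
  moreover have "homeomorphic_map (subtopology X (cdom c)) (top_of_set (cmap c ` cdom c)) (cmap c)"
    using smooth_manifold assms by (auto simp: smooth_manifold_def chart_on_def)
  ultimately show ?thesis
    using homeomorphic_imp_injective_map by (fastforce simp: Int_absorb1)
qed

lemma cinv_cmap [simp]: "c \<in> A \<Longrightarrow> p \<in> cdom c \<Longrightarrow> cinv c (cmap c p) = p"
  by (rule inv_into_f_f[OF inj_on_chart])

lemma open_chart_image:
  assumes "c \<in> A" "openin X W"
  shows "open (cmap c ` (cdom c \<inter> W))"
proof -
  have *: "open (cmap c ` cdom c)" "open_map (subtopology X (cdom c)) (top_of_set (cmap c ` cdom c)) (cmap c)"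
    using smooth_manifold assms(1) homeomorphic_imp_open_map
    by (auto simp: smooth_manifold_def chart_on_def)
  have "openin (subtopology X (cdom c)) (cdom c \<inter> W)"
    using assms(2) by (metis openin_subtopology_Int2)
  then have "openin (top_of_set (cmap c ` cdom c)) (cmap c ` (cdom c \<inter> W))"
    using *(2) by (auto simp: open_map_def)
  then show ?thesis
    using *(1) openin_open_trans by blast
qed

lemma smooth_transition:
  "c \<in> A \<Longrightarrow> c' \<in> A \<Longrightarrow> smooth_on (cmap c ` (cdom c \<inter> cdom c')) (cmap c' \<circ> cinv c)"
  using smooth_manifold by (auto simp: smooth_manifold_def)

lemma differentiable_transition:
  assumes "c \<in> A" "c' \<in> A" "p \<in> cdom c" "p \<in> cdom c'"
  shows "(cmap c' \<circ> cinv c) differentiable (at (cmap c p))"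
  using smooth_on_differentiable[OF smooth_transition[OF assms(1,2)]] assms(3,4) by blast

lemma transition_chain_rule:
  assumes "c \<in> A" "c' \<in> A" "c'' \<in> A" "p \<in> cdom c" "p \<in> cdom c'" "p \<in> cdom c''"
  shows "frechet_derivative (cmap c'' \<circ> cinv c') (at (cmap c' p))
      (frechet_derivative (cmap c' \<circ> cinv c) (at (cmap c p)) v) =
    frechet_derivative (cmap c'' \<circ> cinv c) (at (cmap c p)) v"
proof -
  let ?U = "cmap c ` (cdom c \<inter> (cdom c' \<inter> cdom c''))"
  have cp: "(cmap c' \<circ> cinv c) (cmap c p) = cmap c' p"
    using assms by simp
  have "frechet_derivative (cmap c'' \<circ> cinv c) (at (cmap c p)) =
      frechet_derivative ((cmap c'' \<circ> cinv c') \<circ> (cmap c' \<circ> cinv c)) (at (cmap c p))"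
  proof (rule frechet_derivative_cong_open)
    show "open ?U"
      using assms by (intro open_chart_image openin_Int openin_cdom)
    show "cmap c p \<in> ?U"
      using assms by blast
    fix y assume "y \<in> ?U"
    then show "(cmap c'' \<circ> cinv c) y = ((cmap c'' \<circ> cinv c') \<circ> (cmap c' \<circ> cinv c)) y"
      using assms by auto
  qed
  also have "\<dots> = frechet_derivative (cmap c'' \<circ> cinv c') (at (cmap c' p)) \<circ>
      frechet_derivative (cmap c' \<circ> cinv c) (at (cmap c p))"
    using frechet_derivative_compose[of "cmap c' \<circ> cinv c" "cmap c p" "cmap c'' \<circ> cinv c'"]
      differentiable_transition assms unfolding cp by blast
  finally show ?thesis by simp
qed

lemma transition_self:
  assumes "c \<in> A" "p \<in> cdom c"
  shows "frechet_derivative (cmap c \<circ> cinv c) (at (cmap c p)) v = v"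
proof -
  have "frechet_derivative (cmap c \<circ> cinv c) (at (cmap c p)) = frechet_derivative (\<lambda>u. u) (at (cmap c p))"
    using assms open_chart_image[OF assms(1) openin_cdom[OF assms(1)]]
    by (intro frechet_derivative_cong_open[of "cmap c ` (cdom c \<inter> cdom c)"]) auto
  then show ?thesis by simp
qed

lemma subspace_tangent_space:
  assumes "p \<in> topspace X"
  shows "subspace (tangent_space A p)"
proof -
  have lin: "linear (frechet_derivative (cmap c' \<circ> cinv c) (at (cmap c p)))"
    if "c \<in> A" "c' \<in> A" "p \<in> cdom c" "p \<in> cdom c'" for c c'
    using that by (intro linear_frechet_derivative differentiable_transition)
  show ?thesis
  proof (rule subspaceI)
    show "0 \<in> tangent_space A p"
      using linear_0[OF lin] by (auto simp: tangent_space_def)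
    fix u v r assume u: "u \<in> tangent_space A p"
    have *: "coords w c' = frechet_derivative (cmap c' \<circ> cinv c) (at (cmap c p)) (coords w c)"
      if "w \<in> tangent_space A p" "c \<in> A" "c' \<in> A" "p \<in> cdom c \<inter> cdom c'" for w c c'
      using that unfolding tangent_space_def by blast
    have **: "coords w c = 0" if "w \<in> tangent_space A p" "\<not> (c \<in> A \<and> p \<in> cdom c)" for w c
      using that unfolding tangent_space_def by blast
    show "r *\<^sub>R u \<in> tangent_space A p"
      unfolding tangent_space_def
    proof (intro CollectI conjI ballI impI allI)
      fix c c' assume c: "c \<in> A" "c' \<in> A" "p \<in> cdom c \<inter> cdom c'"
      show "coords (r *\<^sub>R u) c' =
          frechet_derivative (cmap c' \<circ> cinv c) (at (cmap c p)) (coords (r *\<^sub>R u) c)"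
        unfolding coords_simps *[OF u c] using lin[of c c'] c by (subst linear_scale) auto
    next
      fix c assume "\<not> (c \<in> A \<and> p \<in> cdom c)"
      then show "coords (r *\<^sub>R u) c = 0"
        unfolding coords_simps by (subst **[OF u]) auto
    qed
    assume v: "v \<in> tangent_space A p"
    show "u + v \<in> tangent_space A p"
      unfolding tangent_space_def
    proof (intro CollectI conjI ballI impI allI)
      fix c c' assume c: "c \<in> A" "c' \<in> A" "p \<in> cdom c \<inter> cdom c'"
      show "coords (u + v) c' =
          frechet_derivative (cmap c' \<circ> cinv c) (at (cmap c p)) (coords (u + v) c)"
        unfolding coords_simps *[OF u c] *[OF v c] using lin[of c c'] c by (subst linear_add) auto
    next
      fix c assume c: "\<not> (c \<in> A \<and> p \<in> cdom c)"
      show "coords (u + v) c = 0"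
        unfolding coords_simps **[OF u c] **[OF v c] by simp
    qed
  qed
qed

text \<open>The vector field on the domain of \<open>c\<close> whose coordinate vector in the chart \<open>c\<close> is constantly
  \<open>v\<close>. Its coordinates in the other charts are forced by the transformation rule.\<close>

definition const_field :: "('a, 'e) chart \<Rightarrow> 'e \<Rightarrow> 'a \<Rightarrow> ('a, 'e) tvec" where
  "const_field c v q = Tvec (\<lambda>c'. if c' \<in> A \<and> q \<in> cdom c'
     then frechet_derivative (cmap c' \<circ> cinv c) (at (cmap c q)) v else 0)"

lemma coords_const_field:
  "coords (const_field c v q) c' = (if c' \<in> A \<and> q \<in> cdom c'
     then frechet_derivative (cmap c' \<circ> cinv c) (at (cmap c q)) v else 0)"
  by (simp add: const_field_def Tvec_inverse)

lemma const_field_tangent: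
  assumes "c \<in> A" "q \<in> cdom c"
  shows "const_field c v q \<in> tangent_space A q"
  unfolding tangent_space_def
proof (intro CollectI conjI ballI impI allI)
  fix c' c'' assume "c' \<in> A" "c'' \<in> A" "q \<in> cdom c' \<inter> cdom c''"
  then show "coords (const_field c v q) c'' = frechet_derivative (cmap c'' \<circ> cinv c') (at (cmap c' q))
      (coords (const_field c v q) c')"
    using transition_chain_rule[of c c' c'' q v] assms by (simp add: coords_const_field)
qed (auto simp: coords_const_field)

lemma const_field_coords:
  assumes "c \<in> A" "q \<in> cdom c" "y \<in> tangent_space A q"
  shows "const_field c (coords y c) q = y"
proof (rule tvec_eqI)
  fix c'
  show "coords (const_field c (coords y c) q) c' = coords y c'"
  proof (cases "c' \<in> A \<and> q \<in> cdom c'")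
    case True
    then have "coords y c' = frechet_derivative (cmap c' \<circ> cinv c) (at (cmap c q)) (coords y c)"
      using assms unfolding tangent_space_def by blast
    then show ?thesis
      using True by (simp add: coords_const_field)
  next
    case False
    then have "coords y c' = 0"
      using assms unfolding tangent_space_def by blast
    then show ?thesis
      using False by (auto simp: coords_const_field)
  qed
qed

lemma linear_const_field:
  assumes "c \<in> A" "q \<in> cdom c"
  shows "linear (\<lambda>v. const_field c v q)"
proof -
  have lin: "linear (frechet_derivative (cmap c' \<circ> cinv c) (at (cmap c q)))"
    if "c' \<in> A" "q \<in> cdom c'" for c'
    using that assms by (intro linear_frechet_derivative differentiable_transition)
  show ?thesis
  proof (rule linearI; rule tvec_eqI)
    fix u v r c'
    show "coords (const_field c (u + v) q) c' = coords (const_field c u q + const_field c v q) c'"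
      using linear_add[OF lin, of c'] by (auto simp: coords_const_field)
    show "coords (const_field c (r *\<^sub>R u) q) c' = coords (r *\<^sub>R const_field c u q) c'"
      using linear_scale[OF lin, of c'] by (auto simp: coords_const_field)
  qed
qed

lemma inj_const_field:
  assumes "c \<in> A" "q \<in> cdom c"
  shows "inj (\<lambda>v. const_field c v q)"
proof (rule injI)
  fix u v assume "const_field c u q = const_field c v q"
  then have "coords (const_field c u q) c = coords (const_field c v q) c" by simp
  then show "u = v"
    using assms by (simp add: coords_const_field transition_self)
qed

text \<open>In another chart \<open>c'\<close> the coordinates of the field are a directional derivative of the smooth
  transition from \<open>c\<close> to \<open>c'\<close>, composed with the smooth transition back.\<close>

lemma smooth_const_field:
  assumes "c \<in> A"
  shows "smooth_vfield X A (cdom c) (const_field c v)"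
  unfolding smooth_vfield_def
proof (intro conjI ballI)
  show "openin X (cdom c)"
    by (rule openin_cdom[OF assms])
  show "const_field c v q \<in> tangent_space A q" if "q \<in> cdom c" for q
    by (rule const_field_tangent[OF assms that])
  fix c' assume c': "c' \<in> A"
  let ?U = "cmap c' ` (cdom c' \<inter> cdom c)"
  let ?V = "cmap c ` (cdom c \<inter> cdom c')"
  let ?D = "\<lambda>w. frechet_derivative (cmap c' \<circ> cinv c) (at w) v"
  have U: "open ?U"
    by (intro open_chart_image c' openin_cdom assms)
  have eq: "coords (const_field c v (cinv c' u)) c' = ?D ((cmap c \<circ> cinv c') u)" if "u \<in> ?U" for u
    using that c' by (auto simp: coords_const_field)
  have "C_k_on k ?U (\<lambda>u. ?D ((cmap c \<circ> cinv c') u))" for k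
  proof (rule C_k_on_compose[OF U, where g = ?D and V = ?V])
    show "(cmap c \<circ> cinv c') ` ?U \<subseteq> ?V"
      using c' by auto
    show "C_k_on k ?U (cmap c \<circ> cinv c')"
      using smooth_transition[OF c' assms] by (simp add: smooth_on_def)
    show "C_k_on k ?V ?D"
      using smooth_on_derivative[OF smooth_transition[OF assms c']] by (simp add: smooth_on_def)
  qed
  then show "smooth_on ?U (\<lambda>u. coords (const_field c v (cinv c' u)) c')"
    unfolding smooth_on_def using C_k_on_cong[OF U eq] by simp
qed

text \<open>A field with constant coordinates witnesses that the choice is not from an empty set.\<close>

lemma vf_extension:
  assumes "p \<in> topspace X" "y \<in> tangent_space A p"
  obtains W where "p \<in> W" "smooth_vfield X A W (vf_extension X A p y)" "vf_extension X A p y p = y"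
proof -
  obtain c where c: "c \<in> A" "p \<in> cdom c"
    using chart_around[OF assms(1)] .
  have "\<exists>Y. (\<exists>W. p \<in> W \<and> smooth_vfield X A W Y) \<and> Y p = y"
    using smooth_const_field[OF c(1)] const_field_coords[OF c assms(2)] c(2) by blast
  then show ?thesis
    using that someI_ex[of "\<lambda>Y. (\<exists>W. p \<in> W \<and> smooth_vfield X A W Y) \<and> Y p = y"]
    unfolding vf_extension_def by blast
qed

lemma smooth_vfield_subset:
  assumes "smooth_vfield X A W Y" "openin X W'" "W' \<subseteq> W"
  shows "smooth_vfield X A W' Y"
proof -
  have "smooth_on (cmap c ` (cdom c \<inter> W')) (\<lambda>u. coords (Y (cinv c u)) c)" if "c \<in> A" for c
  proof (rule smooth_on_subset)
    show "smooth_on (cmap c ` (cdom c \<inter> W)) (\<lambda>u. coords (Y (cinv c u)) c)"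
      using assms(1) that unfolding smooth_vfield_def by blast
    show "cmap c ` (cdom c \<inter> W') \<subseteq> cmap c ` (cdom c \<inter> W)"
      using assms(3) by blast
  qed
  then show ?thesis
    using assms unfolding smooth_vfield_def by blast
qed

lemma dir_deriv_cong:
  assumes "openin X W" "p \<in> W" "\<And>q. q \<in> W \<Longrightarrow> f q = h q"
  shows "dir_deriv A p v f = dir_deriv A p v h"
proof -
  define c where "c = (SOME c. c \<in> A \<and> p \<in> cdom c)"
  have "p \<in> topspace X"
    using assms openin_subset by blast
  then have "\<exists>c. c \<in> A \<and> p \<in> cdom c"
    using chart_around by blast
  then have c: "c \<in> A" "p \<in> cdom c"
    using someI_ex[of "\<lambda>c. c \<in> A \<and> p \<in> cdom c"] unfolding c_def by blast+
  have "frechet_derivative (f \<circ> cinv c) (at (cmap c p)) = frechet_derivative (h \<circ> cinv c) (at (cmap c p))"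
    using assms c by (intro frechet_derivative_cong_open[OF open_chart_image[OF c(1) assms(1)]]) auto
  then show ?thesis
    by (simp add: dir_deriv_def c_def[symmetric])
qed

lemma dir_deriv_locally_const:
  assumes "openin X W" "p \<in> W" "\<And>q. q \<in> W \<Longrightarrow> f q = k"
  shows "dir_deriv A p v f = 0"
proof -
  have "dir_deriv A p v f = dir_deriv A p v (\<lambda>q. k)"
    using assms by (rule dir_deriv_cong)
  also have "\<dots> = 0"
    by (simp add: dir_deriv_def Let_def o_def)
  finally show ?thesis .
qed

end


section \<open>Orthonormal bases for a positive definite form on a subspace\<close>

locale inner_on =
  fixes V :: "'v::real_vector set" and h :: "'v \<Rightarrow> 'v \<Rightarrow> real"
  assumes V: "subspace V"
    and lin_right: "u \<in> V \<Longrightarrow> lin_on V (h u)"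
    and form_commute: "u \<in> V \<Longrightarrow> v \<in> V \<Longrightarrow> h u v = h v u"
    and pos: "u \<in> V \<Longrightarrow> u \<noteq> 0 \<Longrightarrow> h u u > 0"
begin

lemma add_right: "u \<in> V \<Longrightarrow> v \<in> V \<Longrightarrow> w \<in> V \<Longrightarrow> h u (v + w) = h u v + h u w"
  using lin_right unfolding lin_on_def by blast

lemma scale_right: "u \<in> V \<Longrightarrow> v \<in> V \<Longrightarrow> h u (r *\<^sub>R v) = r * h u v"
  using lin_right unfolding lin_on_def by fastforce

lemma zero_right: "u \<in> V \<Longrightarrow> h u 0 = 0"
  using scale_right[of u 0 0] subspace_0[OF V] by simp

lemma sum_right:
  "finite I \<Longrightarrow> u \<in> V \<Longrightarrow> (\<And>i. i \<in> I \<Longrightarrow> f i \<in> V) \<Longrightarrow> h u (\<Sum>i\<in>I. f i) = (\<Sum>i\<in>I. h u (f i))"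
  by (induction I rule: finite_induct) (simp_all add: zero_right add_right subspace_sum[OF V])

lemma diff_right:
  assumes "u \<in> V" "v \<in> V" "w \<in> V"
  shows "h u (v - w) = h u v - h u w"
  using add_right[of u v "(-1) *\<^sub>R w"] scale_right[of u w "-1"] assms subspace_scale[OF V, of w "-1"] by simp

lemma orthonormal_expansion:
  assumes "orthonormal_basis h K B" "finite B" "K \<subseteq> V" "x \<in> K"
  shows "(\<Sum>b\<in>B. h x b *\<^sub>R b) = x"
proof -
  have B: "B \<subseteq> V" "x \<in> span B" "x \<in> V"
    using assms span_superset[of B] by (auto simp: orthonormal_basis_def)
  obtain r where r: "x = (\<Sum>b\<in>B. r b *\<^sub>R b)"
    using B(2) span_finite[OF assms(2)] by auto
  have "h x b = r b" if "b \<in> B" for b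
  proof -
    have "h x b = h b x" using form_commute B that by blast
    also have "\<dots> = (\<Sum>a\<in>B. h b (r a *\<^sub>R a))"
      unfolding r using B that assms(2) subspace_scale[OF V] by (intro sum_right) auto
    also have "\<dots> = (\<Sum>a\<in>B. if a = b then r a else 0)"
      using B that assms(1) by (intro sum.cong) (auto simp: scale_right orthonormal_basis_def subset_iff)
    also have "\<dots> = r b" using assms(2) that by simp
    finally show ?thesis .
  qed
  then show ?thesis using r by simp
qed

lemma orthonormal_sum_square:
  assumes "orthonormal_basis h K B" "finite B" "K \<subseteq> V" "x \<in> K"
  shows "(\<Sum>b\<in>B. h x b * h x b) = h x x"
proof -
  have B: "B \<subseteq> V" "x \<in> V"
    using assms span_superset[of B] by (auto simp: orthonormal_basis_def)
  have "h x x = h x (\<Sum>b\<in>B. h x b *\<^sub>R b)"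
    by (simp add: orthonormal_expansion[OF assms])
  also have "\<dots> = (\<Sum>b\<in>B. h x (h x b *\<^sub>R b))"
    using B assms(2) subspace_scale[OF V] by (intro sum_right) auto
  also have "\<dots> = (\<Sum>b\<in>B. h x b * h x b)"
    using B by (intro sum.cong) (auto simp: scale_right)
  finally show ?thesis by simp
qed

lemma orthonormal_independent:
  assumes "finite B" "B \<subseteq> V" "\<And>u v. u \<in> B \<Longrightarrow> v \<in> B \<Longrightarrow> h u v = (if u = v then 1 else 0)"
  shows "independent B"
  unfolding independent_explicit_finite_subsets
proof (intro allI impI ballI)
  fix C r b
  assume C: "C \<subseteq> B" "finite C" and 0: "(\<Sum>a\<in>C. r a *\<^sub>R a) = 0" and b: "b \<in> C"
  have "0 = h b (\<Sum>a\<in>C. r a *\<^sub>R a)"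
    using 0 b C assms(2) zero_right by auto
  also have "\<dots> = (\<Sum>a\<in>C. h b (r a *\<^sub>R a))"
    using b C assms(2) subspace_scale[OF V] by (intro sum_right) auto
  also have "\<dots> = (\<Sum>a\<in>C. if a = b then r a else 0)"
    using b C assms(2,3) by (intro sum.cong) (auto simp: scale_right subset_iff)
  also have "\<dots> = r b" using C b by simp
  finally show "r b = 0" by simp
qed

text \<open>Gram-Schmidt: remove from the new vector \<open>s\<close> its projection \<open>t\<close> to the span of the
  orthonormal set found so far. If nothing is left, this set still serves; otherwise the
  remainder is normalised and added.\<close>

lemma orthonormal_basis_exists:
  assumes "finite S" "S \<subseteq> V"
  shows "\<exists>B. finite B \<and> orthonormal_basis h (span S) B"
  using assms
proof (induction S rule: finite_induct)
  case empty
  show ?case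
    by (rule exI[of _ "{}"]) (simp add: orthonormal_basis_def independent_empty)
next
  case (insert s S)
  then obtain B where B: "finite B" "independent B" "span B = span S"
    and on: "\<And>u v. u \<in> B \<Longrightarrow> v \<in> B \<Longrightarrow> h u v = (if u = v then 1 else 0)"
    unfolding orthonormal_basis_def by auto
  have BV: "B \<subseteq> V"
    using insert.prems B(3) span_superset[of B] span_minimal[OF _ V, of S] by auto
  define t where "t = (\<Sum>b\<in>B. h s b *\<^sub>R b)"
  define w where "w = s - t"
  have t: "t \<in> span B" "t \<in> V"
    unfolding t_def
    by (intro span_sum span_scale span_base)
      (use BV in \<open>auto intro!: subspace_sum[OF V] subspace_scale[OF V]\<close>)
  have s: "s \<in> V" using insert.prems by simp
  have w: "w \<in> V" unfolding w_def by (rule subspace_diff[OF V s t(2)])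
  have orth: "h b w = 0" if b: "b \<in> B" for b
  proof -
    have "h b t = (\<Sum>a\<in>B. h b (h s a *\<^sub>R a))"
      unfolding t_def using b BV B(1) subspace_scale[OF V] by (intro sum_right) auto
    also have "\<dots> = (\<Sum>a\<in>B. if a = b then h s a else 0)"
      using b BV on by (intro sum.cong) (auto simp: scale_right subset_iff)
    also have "\<dots> = h s b" using B(1) b by simp
    also have "\<dots> = h b s" using form_commute s b BV by blast
    finally have "h b t = h b s" .
    then show ?thesis
      using b BV s t by (simp add: w_def diff_right subset_iff)
  qed
  have span_s: "span (insert s S) = span (insert w B)"
  proof -
    have "span (insert s S) = span (insert s B)"
      by (simp add: span_insert B(3))
    also have "\<dots> = span (insert w B)"
    proof (rule span_eq[THEN iffD2], intro conjI insert_subsetI)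
      have "w + t \<in> span (insert w B)"
        using t(1) by (meson span_add span_base insertI1 span_mono subset_iff subset_insertI)
      then show "s \<in> span (insert w B)" by (simp add: w_def)
      show "w \<in> span (insert s B)"
        unfolding w_def using t(1) by (meson span_diff span_base insertI1 span_mono subset_iff subset_insertI)
    qed (auto intro: span_base)
    finally show ?thesis .
  qed
  show ?case
  proof (cases "w = 0")
    case True
    then have "span (insert s S) = span B"
      using span_s by (simp add: span_insert_0)
    then show ?thesis
      using B on by (auto simp: orthonormal_basis_def)
  next
    case False
    define e where "e = (1 / sqrt (h w w)) *\<^sub>R w"
    have hw: "h w w > 0" by (rule pos[OF w False])
    have e: "e \<in> V" unfolding e_def by (rule subspace_scale[OF V w])
    have be: "h b e = 0" "h e b = 0" if "b \<in> B" for b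
    proof -
      show "h b e = 0"
        unfolding e_def using that BV w orth by (simp add: scale_right subset_iff)
      then show "h e b = 0" using form_commute e that BV by (metis subsetD)
    qed
    have "h e w = h w e" by (rule form_commute[OF e w])
    also have "\<dots> = h w w / sqrt (h w w)"
      unfolding e_def using w by (simp add: scale_right)
    finally have ew: "h e w = h w w / sqrt (h w w)" .
    have "h e e = h e w / sqrt (h w w)"
      using scale_right[OF e w, of "1 / sqrt (h w w)"] by (simp flip: e_def)
    then have ee: "h e e = 1"
      using hw by (simp add: ew)
    have "e \<notin> B"
      using be ee by force
    have on': "h u v = (if u = v then 1 else 0)" if "u \<in> insert e B" "v \<in> insert e B" for u v
      using that on be ee \<open>e \<notin> B\<close> by auto
    have "span (insert e B) = span (insert w B)"
    proof (rule span_eq[THEN iffD2], intro conjI insert_subsetI)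
      show "e \<in> span (insert w B)"
        unfolding e_def by (intro span_scale span_base) simp
      have "sqrt (h w w) *\<^sub>R e \<in> span (insert e B)"
        by (intro span_scale span_base) simp
      then show "w \<in> span (insert e B)"
        using hw by (simp add: e_def)
    qed (auto intro: span_base)
    then show ?thesis
      using B(1) on' e BV span_s orthonormal_independent[of "insert e B"]
      by (intro exI[of _ "insert e B"]) (simp add: orthonormal_basis_def)
  qed
qed

end


section \<open>The structure tensors at a point\<close>

locale apcr_at_point =
  fixes M :: "('a, 'e::euclidean_space) apcr" and nabla :: "('a, 'e) connection"
    and n :: nat and p :: 'a
  assumes apcr: "almost_paracontact_almost_paracomplex_riemannian n M"
    and levi_civita: "levi_civita_connection (mtop M) (atlas M) (metric M) nabla"
    and p: "p \<in> points M"
begin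

abbreviation T where "T \<equiv> tspace M p"
abbreviation g where "g \<equiv> metric M p"
abbreviation \<phi> where "\<phi> \<equiv> phi M p"
abbreviation \<xi> where "\<xi> \<equiv> xi M p"
abbreviation \<eta> where "\<eta> \<equiv> eta M p"
abbreviation F where "F \<equiv> fund_tensor M nabla p"

text \<open>The covariant derivative of \<open>\<eta>\<close>, since \<open>(\<nabla>\<^sub>x \<eta>) y = g (\<nabla>\<^sub>x \<xi>) y\<close>.\<close>

definition nabla_eta where "nabla_eta x y = g (nabla p x (xi M)) y"

sublocale smooth_mfd "mtop M" "atlas M"
  using apcr by unfold_locales (simp add: almost_paracontact_almost_paracomplex_riemannian_def)

lemma riemannian: "riemannian_metric (mtop M) (atlas M) (metric M)"
  using apcr by (simp add: almost_paracontact_almost_paracomplex_riemannian_def)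

sublocale inner_on T g
  using riemannian p subspace_tangent_space[OF p]
  by unfold_locales (auto simp: riemannian_metric_def tensor_0_2_def)

lemma add_left: "u \<in> T \<Longrightarrow> v \<in> T \<Longrightarrow> w \<in> T \<Longrightarrow> g (u + v) w = g u w + g v w"
  using add_right form_commute subspace_add[OF V] by metis

lemma scale_left: "u \<in> T \<Longrightarrow> w \<in> T \<Longrightarrow> g (r *\<^sub>R u) w = r * g u w"
  using scale_right form_commute subspace_scale[OF V] by metis

lemma diff_left: "u \<in> T \<Longrightarrow> v \<in> T \<Longrightarrow> w \<in> T \<Longrightarrow> g (u - v) w = g u w - g v w"
  using diff_right form_commute subspace_diff[OF V] by metis

lemma structure_eqs:
  "\<phi> \<xi> = 0" "\<eta> \<xi> = 1"
  "x \<in> T \<Longrightarrow> \<phi> (\<phi> x) = x - \<eta> x *\<^sub>R \<xi>"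
  "x \<in> T \<Longrightarrow> \<eta> (\<phi> x) = 0"
  "x \<in> T \<Longrightarrow> y \<in> T \<Longrightarrow> g (\<phi> x) (\<phi> y) = g x y - \<eta> x * \<eta> y"
  "x \<in> T \<Longrightarrow> g x \<xi> = \<eta> x"
  using apcr p by (simp_all add: almost_paracontact_almost_paracomplex_riemannian_def)

lemma phi_tensor: "tensor_1_1 (mtop M) (atlas M) (phi M)"
  using apcr by (simp add: almost_paracontact_almost_paracomplex_riemannian_def)

lemma phi_in [simp]: "x \<in> T \<Longrightarrow> \<phi> x \<in> T"
  and phi_add: "x \<in> T \<Longrightarrow> y \<in> T \<Longrightarrow> \<phi> (x + y) = \<phi> x + \<phi> y"
  and phi_scale: "x \<in> T \<Longrightarrow> \<phi> (r *\<^sub>R x) = r *\<^sub>R \<phi> x"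
proof -
  have "lin_on T \<phi>" "\<phi> ` T \<subseteq> T"
    using phi_tensor p by (simp_all add: tensor_1_1_def)
  then show "x \<in> T \<Longrightarrow> \<phi> x \<in> T" "x \<in> T \<Longrightarrow> y \<in> T \<Longrightarrow> \<phi> (x + y) = \<phi> x + \<phi> y"
    "x \<in> T \<Longrightarrow> \<phi> (r *\<^sub>R x) = r *\<^sub>R \<phi> x"
    by (auto simp: lin_on_def)
qed

lemma smooth_xi: "smooth_vfield (mtop M) (atlas M) (points M) (xi M)"
  using apcr by (simp add: almost_paracontact_almost_paracomplex_riemannian_def)

lemma xi_in [simp]: "\<xi> \<in> T"
  using smooth_xi p by (simp add: smooth_vfield_def)

lemma phi_cubed: "x \<in> T \<Longrightarrow> \<phi> (\<phi> (\<phi> x)) = \<phi> x"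
  using structure_eqs(3)[of "\<phi> x"] by (simp add: structure_eqs(4))

lemma horizontal_split: "x \<in> T \<Longrightarrow> x = \<phi> (\<phi> x) + \<eta> x *\<^sub>R \<xi>"
  by (simp add: structure_eqs)

lemma phi_self_adjoint:
  assumes "x \<in> T" "y \<in> T"
  shows "g (\<phi> x) y = g x (\<phi> y)"
proof -
  have "g x (\<phi> y) = g (\<phi> x) (\<phi> (\<phi> y))"
    using structure_eqs(5)[of x "\<phi> y"] assms by (simp add: structure_eqs(4))
  also have "\<dots> = g (\<phi> x) y"
    using assms subspace_scale[OF V] by (simp add: structure_eqs diff_right scale_right)
  finally show ?thesis by simp
qed


subsection \<open>Covariant derivatives at the point\<close>

lemma
  assumes "smooth_vfield (mtop M) (atlas M) W Y" "p \<in> W"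
  shows nabla_in: "x \<in> T \<Longrightarrow> nabla p x Y \<in> T"
    and nabla_linear: "lin_on T (\<lambda>x. nabla p x Y)"
proof -
  have "\<forall>W Y. smooth_vfield (mtop M) (atlas M) W Y \<longrightarrow> (\<forall>p\<in>W.
      lin_on (tspace M p) (\<lambda>v. nabla p v Y) \<and> (\<forall>v\<in>tspace M p. nabla p v Y \<in> tspace M p))"
    using levi_civita unfolding levi_civita_connection_def affine_connection_def by (elim conjE)
  note * = this[rule_format, OF assms]
  show "lin_on T (\<lambda>x. nabla p x Y)"
    by (rule conjunct1[OF *])
  show "nabla p x Y \<in> T" if "x \<in> T"
    using conjunct2[OF *] that by blast
qed

lemma metric_compatible:
  assumes "smooth_vfield (mtop M) (atlas M) W Y" "smooth_vfield (mtop M) (atlas M) W Z" "p \<in> W" "x \<in> T"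
  shows "dir_deriv (atlas M) p x (\<lambda>q. metric M q (Y q) (Z q)) = g (nabla p x Y) (Z p) + g (Y p) (nabla p x Z)"
proof -
  have "\<forall>W Y Z. smooth_vfield (mtop M) (atlas M) W Y \<longrightarrow> smooth_vfield (mtop M) (atlas M) W Z \<longrightarrow>
      (\<forall>p\<in>W. \<forall>v\<in>tspace M p. dir_deriv (atlas M) p v (\<lambda>q. metric M q (Y q) (Z q)) =
        metric M p (nabla p v Y) (Z p) + metric M p (Y p) (nabla p v Z))"
    using levi_civita unfolding levi_civita_connection_def by (elim conjE)
  from this[rule_format, OF assms] show ?thesis .
qed

lemma torsion_free:
  assumes "smooth_vfield (mtop M) (atlas M) W Y" "smooth_vfield (mtop M) (atlas M) W Z" "p \<in> W"
  shows "nabla p (Y p) Z - nabla p (Z p) Y = lie_bracket (atlas M) Y Z p"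
proof -
  have "\<forall>W Y Z. smooth_vfield (mtop M) (atlas M) W Y \<longrightarrow> smooth_vfield (mtop M) (atlas M) W Z \<longrightarrow>
      (\<forall>p\<in>W. nabla p (Y p) Z - nabla p (Z p) Y = lie_bracket (atlas M) Y Z p)"
    using levi_civita unfolding levi_civita_connection_def by (elim conjE)
  from this[rule_format, OF assms] show ?thesis .
qed

lemma smooth_phi:
  "smooth_vfield (mtop M) (atlas M) W Y \<Longrightarrow> smooth_vfield (mtop M) (atlas M) W (\<lambda>q. phi M q (Y q))"
  using phi_tensor unfolding tensor_1_1_def by blast

lemma smooth_vfieldD:
  assumes "smooth_vfield (mtop M) (atlas M) W Y"
  shows "openin (mtop M) W" "q \<in> W \<Longrightarrow> Y q \<in> tspace M q" "q \<in> W \<Longrightarrow> apcr_at_point M nabla n q"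
  using assms openin_subset[of "mtop M" W] apcr levi_civita
  by (auto simp: smooth_vfield_def apcr_at_point_def)

lemma smooth_xi_on:
  assumes "smooth_vfield (mtop M) (atlas M) W Y"
  shows "smooth_vfield (mtop M) (atlas M) W (xi M)"
  using smooth_vfield_subset[OF smooth_xi smooth_vfieldD(1)[OF assms]] smooth_vfieldD(1)[OF assms]
  by (simp add: openin_subset)

lemma common_extension:
  assumes "y \<in> T" "z \<in> T"
  obtains W where "p \<in> W"
    "smooth_vfield (mtop M) (atlas M) W (vf_extension (mtop M) (atlas M) p y)"
    "smooth_vfield (mtop M) (atlas M) W (vf_extension (mtop M) (atlas M) p z)"
    "vf_extension (mtop M) (atlas M) p y p = y" "vf_extension (mtop M) (atlas M) p z p = z"
proof -
  obtain W1 where 1: "p \<in> W1" "smooth_vfield (mtop M) (atlas M) W1 (vf_extension (mtop M) (atlas M) p y)"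
    "vf_extension (mtop M) (atlas M) p y p = y"
    using vf_extension[OF p assms(1)] .
  obtain W2 where 2: "p \<in> W2" "smooth_vfield (mtop M) (atlas M) W2 (vf_extension (mtop M) (atlas M) p z)"
    "vf_extension (mtop M) (atlas M) p z p = z"
    using vf_extension[OF p assms(2)] .
  have "openin (mtop M) (W1 \<inter> W2)"
    using smooth_vfieldD(1)[OF 1(2)] smooth_vfieldD(1)[OF 2(2)] by (rule openin_Int)
  then show ?thesis
    using that[of "W1 \<inter> W2"] 1 2 smooth_vfield_subset[OF 1(2)] smooth_vfield_subset[OF 2(2)] by simp
qed

lemma nabla_phi_in: "x \<in> T \<Longrightarrow> y \<in> T \<Longrightarrow> nabla_phi M nabla p x y \<in> T"
  unfolding nabla_phi_def Let_def
  by (rule common_extension[of y y])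
    (assumption | rule subspace_diff[OF V] phi_in nabla_in[OF smooth_phi] nabla_in)+

lemma nabla_phi_linear:
  assumes "y \<in> T"
  shows "lin_on T (\<lambda>x. nabla_phi M nabla p x y)"
proof -
  define Y where "Y = vf_extension (mtop M) (atlas M) p y"
  obtain W where W: "p \<in> W" "smooth_vfield (mtop M) (atlas M) W Y"
    using common_extension[OF assms assms] unfolding Y_def by metis
  have l: "lin_on T (\<lambda>x. nabla p x Y)" "lin_on T (\<lambda>x. nabla p x (\<lambda>q. phi M q (Y q)))"
    using nabla_linear[OF W(2,1)] nabla_linear[OF smooth_phi[OF W(2)] W(1)] by auto
  show ?thesis
    using l nabla_in[OF W(2,1)]
    by (simp add: nabla_phi_def Y_def[symmetric] lin_on_def phi_add phi_scale algebra_simps)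
qed

lemma fund_tensor_expand:
  fixes y defines "Y \<equiv> vf_extension (mtop M) (atlas M) p y"
  assumes "x \<in> T" "z \<in> T" "p \<in> W" "smooth_vfield (mtop M) (atlas M) W Y"
  shows "F x y z = g (nabla p x (\<lambda>q. phi M q (Y q))) z - g (nabla p x Y) (\<phi> z)"
  using assms(2-4) nabla_in[OF smooth_phi[OF assms(5)]] nabla_in[OF assms(5)]
  by (simp add: fund_tensor_def nabla_phi_def Y_def[symmetric] diff_left phi_self_adjoint)

text \<open>Differentiate the identity \<open>g (\<phi> Y) Z = g Y (\<phi> Z)\<close> along \<open>x\<close>. By its definition \<open>F\<close> is linear in
  its last argument, whereas its middle argument enters through a chosen extension; this
  symmetry transfers the linearity to the middle argument.\<close>

lemma fund_tensor_sym:
  assumes "x \<in> T" "y \<in> T" "z \<in> T"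
  shows "F x y z = F x z y"
proof -
  define Y where "Y = vf_extension (mtop M) (atlas M) p y"
  define Z where "Z = vf_extension (mtop M) (atlas M) p z"
  obtain W where W: "p \<in> W" "smooth_vfield (mtop M) (atlas M) W Y" "smooth_vfield (mtop M) (atlas M) W Z"
    and YZ: "Y p = y" "Z p = z"
    using common_extension[OF assms(2,3)] unfolding Y_def Z_def by metis
  note sm = smooth_phi[OF W(2)] smooth_phi[OF W(3)]
  have "dir_deriv (atlas M) p x (\<lambda>q. metric M q (phi M q (Y q)) (Z q)) =
      dir_deriv (atlas M) p x (\<lambda>q. metric M q (Y q) (phi M q (Z q)))"
  proof (rule dir_deriv_cong[OF smooth_vfieldD(1)[OF W(2)] W(1)])
    fix q assume "q \<in> W"
    then show "metric M q (phi M q (Y q)) (Z q) = metric M q (Y q) (phi M q (Z q))"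
      by (intro apcr_at_point.phi_self_adjoint[OF smooth_vfieldD(3)[OF W(2)]]
          smooth_vfieldD(2)[OF W(2)] smooth_vfieldD(2)[OF W(3)])
  qed
  then have "g (nabla p x (\<lambda>q. phi M q (Y q))) z + g (\<phi> y) (nabla p x Z) =
      g (nabla p x Y) (\<phi> z) + g y (nabla p x (\<lambda>q. phi M q (Z q)))"
    using metric_compatible[OF sm(1) W(3,1) assms(1)] metric_compatible[OF W(2) sm(2) W(1) assms(1)] YZ
    by simp
  moreover have "g (\<phi> y) (nabla p x Z) = g (nabla p x Z) (\<phi> y)"
    "g y (nabla p x (\<lambda>q. phi M q (Z q))) = g (nabla p x (\<lambda>q. phi M q (Z q))) y"
    using assms nabla_in[OF W(3,1)] nabla_in[OF sm(2) W(1)] by (intro form_commute; simp)+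
  ultimately show ?thesis
    using fund_tensor_expand[of x z W y] fund_tensor_expand[of x y W z] assms W
    unfolding Y_def[symmetric] Z_def[symmetric] by simp
qed

lemma fund_tensor_add1:
  "u \<in> T \<Longrightarrow> v \<in> T \<Longrightarrow> y \<in> T \<Longrightarrow> z \<in> T \<Longrightarrow> F (u + v) y z = F u y z + F v y z"
  using nabla_phi_linear[of y] unfolding fund_tensor_def lin_on_def by (metis add_left nabla_phi_in)

lemma fund_tensor_scale1:
  "u \<in> T \<Longrightarrow> y \<in> T \<Longrightarrow> z \<in> T \<Longrightarrow> F (r *\<^sub>R u) y z = r * F u y z"
  using nabla_phi_linear[of y] unfolding fund_tensor_def lin_on_def by (metis scale_left nabla_phi_in)

lemma fund_tensor_add3:
  "x \<in> T \<Longrightarrow> y \<in> T \<Longrightarrow> u \<in> T \<Longrightarrow> v \<in> T \<Longrightarrow> F x y (u + v) = F x y u + F x y v"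
  unfolding fund_tensor_def by (simp add: add_right nabla_phi_in)

lemma fund_tensor_scale3:
  "x \<in> T \<Longrightarrow> y \<in> T \<Longrightarrow> u \<in> T \<Longrightarrow> F x y (r *\<^sub>R u) = r * F x y u"
  unfolding fund_tensor_def by (simp add: scale_right nabla_phi_in)

lemma fund_tensor_split1:
  assumes "x \<in> T" "y \<in> T" "z \<in> T"
  shows "F x y z = F (\<phi> (\<phi> x)) y z + \<eta> x * F \<xi> y z"
proof -
  have "F x y z = F (\<phi> (\<phi> x) + \<eta> x *\<^sub>R \<xi>) y z"
    by (simp only: horizontal_split[OF assms(1), symmetric])
  then show ?thesis
    using assms by (simp add: fund_tensor_add1 fund_tensor_scale1 subspace_scale[OF V])
qed

lemma fund_tensor_split3:
  assumes "x \<in> T" "y \<in> T" "z \<in> T"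
  shows "F x y z = F x y (\<phi> (\<phi> z)) + \<eta> z * F x y \<xi>"
proof -
  have "F x y z = F x y (\<phi> (\<phi> z) + \<eta> z *\<^sub>R \<xi>)"
    by (simp only: horizontal_split[OF assms(3), symmetric])
  then show ?thesis
    using assms by (simp add: fund_tensor_add3 fund_tensor_scale3 subspace_scale[OF V])
qed

lemma nabla_xi_in: "x \<in> T \<Longrightarrow> nabla p x (xi M) \<in> T"
  by (rule nabla_in[OF smooth_xi p])

text \<open>Differentiate \<open>g \<xi> \<xi> = 1\<close>.\<close>

lemma nabla_eta_xi:
  assumes "x \<in> T"
  shows "nabla_eta x \<xi> = 0"
proof -
  have "dir_deriv (atlas M) p x (\<lambda>q. metric M q (xi M q) (xi M q)) = 0"
  proof (rule dir_deriv_locally_const[OF smooth_vfieldD(1)[OF smooth_xi] p])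
    fix q assume q: "q \<in> points M"
    show "metric M q (xi M q) (xi M q) = 1"
      using apcr_at_point.structure_eqs(2,6)[OF smooth_vfieldD(3)[OF smooth_xi q]]
        apcr_at_point.xi_in[OF smooth_vfieldD(3)[OF smooth_xi q]] by simp
  qed
  then show ?thesis
    using metric_compatible[OF smooth_xi smooth_xi p assms] form_commute[OF xi_in nabla_xi_in[OF assms]]
    by (simp add: nabla_eta_def)
qed

text \<open>Differentiate \<open>g (\<phi> Z) \<xi> = 0\<close>.\<close>

lemma fund_tensor_xi:
  assumes "x \<in> T" "z \<in> T"
  shows "F x z \<xi> = - nabla_eta x (\<phi> z)"
proof -
  define Z where "Z = vf_extension (mtop M) (atlas M) p z"
  obtain W where W: "p \<in> W" "smooth_vfield (mtop M) (atlas M) W Z" and Z: "Z p = z"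
    using common_extension[OF assms(2) assms(2)] unfolding Z_def by metis
  note sm = smooth_phi[OF W(2)] smooth_xi_on[OF W(2)]
  have "dir_deriv (atlas M) p x (\<lambda>q. metric M q (phi M q (Z q)) (xi M q)) = 0"
  proof (rule dir_deriv_locally_const[OF smooth_vfieldD(1)[OF W(2)] W(1)])
    fix q assume q: "q \<in> W"
    show "metric M q (phi M q (Z q)) (xi M q) = 0"
      using apcr_at_point.structure_eqs(4,6)[OF smooth_vfieldD(3)[OF W(2) q]] smooth_vfieldD(2)[OF W(2) q]
        apcr_at_point.phi_in[OF smooth_vfieldD(3)[OF W(2) q]] by simp
  qed
  then have "g (nabla p x (\<lambda>q. phi M q (Z q))) \<xi> = - g (\<phi> z) (nabla p x (xi M))"
    using metric_compatible[OF sm W(1) assms(1)] Z by simp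
  moreover have "g (nabla p x Z) (\<phi> \<xi>) = 0"
    using nabla_in[OF W(2,1) assms(1)] by (simp add: structure_eqs(1) zero_right)
  ultimately show ?thesis
    using fund_tensor_expand[of x \<xi> W z] W assms form_commute[OF phi_in[OF assms(2)] nabla_xi_in[OF assms(1)]]
    unfolding Z_def[symmetric] by (simp add: nabla_eta_def)
qed

text \<open>Compatibility with the metric turns \<open>\<xi>(g(X, Y))\<close> into \<open>g(\<nabla>\<^sub>\<xi> X, Y) + g(X, \<nabla>\<^sub>\<xi> Y)\<close>, and the brackets
  are \<open>[\<xi>, X] = \<nabla>\<^sub>\<xi> X - \<nabla>\<^sub>X \<xi>\<close>, so that only the derivatives of \<open>\<xi>\<close> survive.\<close>

lemma lie_deriv_metric_eq:
  assumes "x \<in> T" "y \<in> T"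
  shows "lie_deriv_metric M p x y = nabla_eta x y + nabla_eta y x"
proof -
  define X where "X = vf_extension (mtop M) (atlas M) p x"
  define Y where "Y = vf_extension (mtop M) (atlas M) p y"
  obtain W where W: "p \<in> W" "smooth_vfield (mtop M) (atlas M) W X" "smooth_vfield (mtop M) (atlas M) W Y"
    and XY: "X p = x" "Y p = y"
    using common_extension[OF assms] unfolding X_def Y_def by metis
  note sx = smooth_xi_on[OF W(2)]
  have br: "lie_bracket (atlas M) (xi M) X p = nabla p \<xi> X - nabla p x (xi M)"
    "lie_bracket (atlas M) (xi M) Y p = nabla p \<xi> Y - nabla p y (xi M)"
    using torsion_free[OF sx W(2,1)] torsion_free[OF sx W(3,1)] XY by simp_all
  have inT: "nabla p \<xi> X \<in> T" "nabla p \<xi> Y \<in> T" "nabla p x (xi M) \<in> T" "nabla p y (xi M) \<in> T"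
    using nabla_in[OF W(2,1)] nabla_in[OF W(3,1)] nabla_xi_in assms by simp_all
  have "lie_deriv_metric M p x y = g (nabla p \<xi> X) y + g x (nabla p \<xi> Y)
      - g (nabla p \<xi> X - nabla p x (xi M)) y - g x (nabla p \<xi> Y - nabla p y (xi M))"
    using metric_compatible[OF W(2,3,1) xi_in] XY
    by (simp add: lie_deriv_metric_def X_def[symmetric] Y_def[symmetric] br)
  also have "\<dots> = nabla_eta x y + nabla_eta y x"
    using assms inT form_commute[of x "nabla p y (xi M)"] by (simp add: diff_left diff_right nabla_eta_def)
  finally show ?thesis .
qed


subsection \<open>Orthonormal bases of the horizontal space\<close>

text \<open>In the coordinates of a chart the horizontal space is the kernel of a nonzero linear
  functional, hence a hyperplane of the coordinate space, which has dimension \<open>2 n + 1\<close>.\<close>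

lemma ker_eta_dim:
  obtains S where "finite S" "independent S" "span S = ker_eta M p" "card S = 2 * n"
proof -
  obtain c where c: "c \<in> atlas M" "p \<in> cdom c"
    using chart_around[OF p] .
  define L where "L = (\<lambda>v. const_field c v p)"
  have L: "linear L" "inj L"
    unfolding L_def using linear_const_field[OF c] inj_const_field[OF c] by auto
  have LT: "L v \<in> T" for v
    unfolding L_def by (rule const_field_tangent[OF c])
  have onto: "\<exists>v. L v = y" if "y \<in> T" for y
    unfolding L_def using const_field_coords[OF c that] by blast
  have lin: "linear (\<lambda>v. \<eta> (L v))"
  proof (rule linearI)
    fix u v r
    show "\<eta> (L (u + v)) = \<eta> (L u) + \<eta> (L v)" "\<eta> (L (r *\<^sub>R u)) = r *\<^sub>R \<eta> (L u)"
      using LT linear_add[OF L(1), of u v] linear_scale[OF L(1), of r u] subspace_add[OF V] subspace_scale[OF V]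
        add_left[OF LT LT xi_in, of u v] scale_left[OF LT xi_in, of r u] by (simp_all add: structure_eqs(6))
  qed
  define a where "a = adjoint (\<lambda>v. \<eta> (L v)) 1"
  have a: "\<eta> (L v) = a \<bullet> v" for v
    using adjoint_works[OF lin, of v 1] by (simp add: a_def inner_commute)
  obtain v where "L v = \<xi>"
    using onto[OF xi_in] by blast
  then have "a \<noteq> 0"
    using a[of v] structure_eqs(2) by auto
  then have "dim {v. a \<bullet> v = 0} = 2 * n"
    using apcr by (simp add: dim_hyperplane almost_paracontact_almost_paracomplex_riemannian_def)
  then obtain B where B: "B \<subseteq> {v. a \<bullet> v = 0}" "independent B" "{v. a \<bullet> v = 0} \<subseteq> span B" "card B = 2 * n"
    using basis_exists[of "{v. a \<bullet> v = 0}"] by metis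
  have sp: "span B = {v. a \<bullet> v = 0}"
    using B span_minimal[OF B(1) subspace_hyperplane] by blast
  show ?thesis
  proof
    show "finite (L ` B)"
      using B(2) by (simp add: finiteI_independent)
    show "independent (L ` B)"
      using L B(2) by (intro linear_independent_injective_image) (auto intro: inj_on_subset)
    have "span (L ` B) = L ` {v. a \<bullet> v = 0}"
      by (simp add: linear_span_image[OF L(1)] sp)
    also have "\<dots> = ker_eta M p"
      using LT onto by (auto simp: ker_eta_def a[symmetric])
    finally show "span (L ` B) = ker_eta M p" .
    show "card (L ` B) = 2 * n"
      using B(4) card_image[OF inj_on_subset[OF L(2)]] by simp
  qed
qed

lemma ker_eta_basis:
  shows "orthonormal_basis g (ker_eta M p) (ker_eta_basis M p)"
    and "card (ker_eta_basis M p) = 2 * n"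
proof -
  obtain S where S: "finite S" "independent S" "span S = ker_eta M p" "card S = 2 * n"
    by (rule ker_eta_dim)
  have "S \<subseteq> T"
    using S(3) span_superset[of S] by (auto simp: ker_eta_def)
  then have "\<exists>B. orthonormal_basis g (ker_eta M p) B"
    using orthonormal_basis_exists[OF S(1)] S(3) by auto
  then show *: "orthonormal_basis g (ker_eta M p) (ker_eta_basis M p)"
    unfolding ker_eta_basis_def by (rule someI_ex)
  then show "card (ker_eta_basis M p) = 2 * n"
    using S dim_span_eq_card_independent[of S] dim_span_eq_card_independent[of "ker_eta_basis M p"]
    by (simp add: orthonormal_basis_def)
qed

end


section \<open>The paracontact condition\<close>

locale paracontact_at_point = apcr_at_point +
  assumes contact: "x \<in> T \<Longrightarrow> y \<in> T \<Longrightarrow> 2 * g x (\<phi> y) = lie_deriv_metric M p x y"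
begin

lemma nabla_eta_sym: "x \<in> T \<Longrightarrow> y \<in> T \<Longrightarrow> nabla_eta x y + nabla_eta y x = 2 * g x (\<phi> y)"
  using contact lie_deriv_metric_eq by simp

text \<open>The Reeb field is geodesic: both \<open>(\<nabla>\<^sub>y \<eta>) \<xi>\<close> and \<open>g y (\<phi> \<xi>)\<close> vanish.\<close>

lemma nabla_xi_eta: "y \<in> T \<Longrightarrow> nabla_eta \<xi> y = 0"
  using nabla_eta_sym[of y \<xi>] by (simp add: nabla_eta_xi structure_eqs(1) zero_right)

text \<open>By the formula for \<open>F\<close> along \<open>\<xi>\<close>, the left-hand side is minus twice the symmetric part of \<open>\<nabla>\<eta>\<close>
  at the pair \<open>\<phi>\<^sup>2 x\<close>, \<open>\<phi> y\<close>; swapping the arguments of \<open>c\<close> is what pairs the two terms.\<close>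

lemma b_form_plus_c_form:
  assumes "x \<in> T" "y \<in> T"
  shows "b_form M nabla p x y + c_form M nabla p y x = - 2 * g (\<phi> x) (\<phi> y)"
proof -
  have "b_form M nabla p x y + c_form M nabla p y x =
      - (nabla_eta (\<phi> (\<phi> x)) (\<phi> y) + nabla_eta (\<phi> y) (\<phi> (\<phi> x)))"
    using assms by (simp add: b_form_def c_form_def fund_tensor_xi phi_cubed)
  also have "\<dots> = - 2 * g (\<phi> (\<phi> x)) (\<phi> (\<phi> y))"
    using assms by (subst nabla_eta_sym) auto
  also have "\<dots> = - 2 * g (\<phi> x) (\<phi> y)"
    using assms structure_eqs(5)[of "\<phi> x" "\<phi> y"] by (simp add: structure_eqs(4))
  finally show ?thesis .
qed

text \<open>Splitting each argument into its horizontal part and its \<open>\<xi>\<close>-part gives eight terms. The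
  three of them with \<open>\<xi>\<close> in the first argument and in another one, and the one with \<open>\<xi>\<close> in the last two
  arguments only, vanish because \<open>(\<nabla>\<^sub>\<xi> \<eta>) = 0\<close> and \<open>\<phi> \<xi> = 0\<close>.\<close>

lemma fund_tensor_decomposition:
  assumes "x \<in> T" "y \<in> T" "z \<in> T"
  shows "F x y z = F (\<phi> (\<phi> x)) (\<phi> (\<phi> y)) (\<phi> (\<phi> z)) + eta_sym M p (b_form M nabla p) x y z
    + \<eta> x * F \<xi> (\<phi> (\<phi> y)) (\<phi> (\<phi> z))"
proof -
  have xi_part: "F x (\<phi> (\<phi> u)) \<xi> = b_form M nabla p x u" if "u \<in> T" for u
    using fund_tensor_split1[of x "\<phi> (\<phi> u)" \<xi>] assms(1) that
    by (simp add: b_form_def fund_tensor_xi nabla_xi_eta)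
  have "F x \<xi> \<xi> = 0"
    using assms(1) by (simp add: fund_tensor_xi structure_eqs(1) nabla_eta_def zero_right nabla_xi_in)
  then have "F x y z = F x (\<phi> (\<phi> y)) (\<phi> (\<phi> z)) + \<eta> z * F x (\<phi> (\<phi> y)) \<xi> + \<eta> y * F x (\<phi> (\<phi> z)) \<xi>"
    using assms fund_tensor_split3[of x y z] fund_tensor_split3[of x "\<phi> (\<phi> z)" y]
      fund_tensor_split3[of x \<xi> y] fund_tensor_sym[of x y "\<phi> (\<phi> z)"] fund_tensor_sym[of x y \<xi>]
      fund_tensor_sym[of x "\<phi> (\<phi> y)" \<xi>] fund_tensor_sym[of x "\<phi> (\<phi> y)" "\<phi> (\<phi> z)"]
    by simp
  then show ?thesis
    using assms xi_part fund_tensor_split1[of x "\<phi> (\<phi> y)" "\<phi> (\<phi> z)"]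
    by (simp add: eta_sym_def mult.commute)
qed

lemma horizontal_components:
  "F1 M nabla n p x y z + F2 M nabla n p x y z + F3 M nabla n p x y z =
    F (\<phi> (\<phi> x)) (\<phi> (\<phi> y)) (\<phi> (\<phi> z))"
  by (simp add: F2_def F3_def Let_def field_simps)

lemma F4'_eq:
  assumes "n \<ge> 1"
  shows "F4' M nabla n p x y z = - g (\<phi> x) (\<phi> y) * \<eta> z - g (\<phi> x) (\<phi> z) * \<eta> y"
  using assms by (simp add: F4'_def eta_sym_def)

text \<open>\<open>F\<^sub>7 + F\<^sub>8\<close> comes from the bilinear form \<open>(b(x, y) - c(y, x)) / 2\<close>, which equals
  \<open>b(x, y) + g (\<phi> x) (\<phi> y)\<close> by \<open>b_form_plus_c_form\<close>.\<close>

lemma mixed_components: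
  assumes "n \<ge> 1" "x \<in> T" "y \<in> T" "z \<in> T"
  shows "F4' M nabla n p x y z + F7 M nabla n p x y z + F8 M nabla n p x y z =
    eta_sym M p (b_form M nabla p) x y z"
proof -
  let ?b = "b_form M nabla p" and ?c = "c_form M nabla p"
  have c: "?c u x = - 2 * g (\<phi> x) (\<phi> u) - ?b x u" if "u \<in> T" for u
    using b_form_plus_c_form[OF assms(2) that] by simp
  show ?thesis
    by (simp add: F4'_eq[OF assms(1)] F7_def F8_def Let_def eta_sym_def c[OF assms(3)] c[OF assms(4)])
      (simp add: field_simps)
qed

text \<open>Expanding \<open>\<phi> e\<close> in the orthonormal basis, \<open>\<theta>(\<xi>)\<close> becomes minus the double sum of
  \<open>g (\<phi> e) e' * (\<nabla>\<^sub>e \<eta>) e'\<close>. Its first factor is symmetric in \<open>e\<close> and \<open>e'\<close>, so only the symmetric part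
  \<open>g e (\<phi> e')\<close> of \<open>\<nabla>\<eta>\<close> contributes, and this leaves the squared norm of \<open>\<phi>\<close> on the horizontal space,
  where \<open>\<phi>\<close> is an isometry.\<close>

lemma lee_theta_xi:
  assumes "n \<ge> 1"
  shows "lee_theta M nabla p \<xi> = - 2 * real n"
proof -
  define B where "B = ker_eta_basis M p"
  have on: "orthonormal_basis g (ker_eta M p) B" and card: "card B = 2 * n"
    unfolding B_def by (rule ker_eta_basis)+
  have fin: "finite B"
    using card assms by (intro card_ge_0_finite) simp
  have ker: "ker_eta M p \<subseteq> T"
    by (auto simp: ker_eta_def)
  have BT: "e \<in> T" "\<eta> e = 0" "\<phi> e \<in> ker_eta M p" "g e e = 1" if "e \<in> B" for e
  proof -
    show T: "e \<in> T" and "\<eta> e = 0"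
      using on that span_superset[of B] by (auto simp: orthonormal_basis_def ker_eta_def)
    show "\<phi> e \<in> ker_eta M p"
      using T by (simp add: ker_eta_def structure_eqs(4))
    show "g e e = 1"
      using on that by (simp add: orthonormal_basis_def)
  qed
  let ?N = "\<lambda>e e'. g (\<phi> e) e' * nabla_eta e e'"
  have expand: "nabla_eta e (\<phi> e) = (\<Sum>e'\<in>B. ?N e e')" if e: "e \<in> B" for e
  proof -
    have "nabla_eta e (\<phi> e) = g (nabla p e (xi M)) (\<Sum>e'\<in>B. g (\<phi> e) e' *\<^sub>R e')"
      using orthonormal_expansion[OF on fin ker BT(3)[OF e]] by (simp add: nabla_eta_def)
    also have "\<dots> = (\<Sum>e'\<in>B. g (nabla p e (xi M)) (g (\<phi> e) e' *\<^sub>R e'))"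
      using fin e BT(1) nabla_xi_in subspace_scale[OF V] by (intro sum_right) auto
    also have "\<dots> = (\<Sum>e'\<in>B. ?N e e')"
      using e BT(1) nabla_xi_in by (intro sum.cong) (auto simp: scale_right nabla_eta_def)
    finally show ?thesis .
  qed
  have phi_sym: "g (\<phi> e) e' = g (\<phi> e') e" if "e \<in> B" "e' \<in> B" for e e'
    using that BT(1) phi_self_adjoint[of e e'] form_commute[of e "\<phi> e'"] by simp
  have "2 * (\<Sum>e\<in>B. \<Sum>e'\<in>B. ?N e e') = (\<Sum>e\<in>B. \<Sum>e'\<in>B. ?N e e') + (\<Sum>e\<in>B. \<Sum>e'\<in>B. ?N e' e)"
    by (subst (3) sum.swap) simp
  also have "\<dots> = (\<Sum>e\<in>B. \<Sum>e'\<in>B. ?N e e' + ?N e' e)"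
    by (simp add: sum.distrib)
  also have "\<dots> = (\<Sum>e\<in>B. \<Sum>e'\<in>B. 2 * (g (\<phi> e) e' * g (\<phi> e) e'))"
  proof (intro sum.cong refl)
    fix e e' assume e: "e \<in> B" "e' \<in> B"
    have "?N e e' + ?N e' e = g (\<phi> e) e' * (nabla_eta e e' + nabla_eta e' e)"
      using phi_sym[OF e] by (simp add: algebra_simps)
    also have "nabla_eta e e' + nabla_eta e' e = 2 * g (\<phi> e) e'"
      using e BT(1) nabla_eta_sym[of e e'] phi_self_adjoint[of e e'] by simp
    finally show "?N e e' + ?N e' e = 2 * (g (\<phi> e) e' * g (\<phi> e) e')" by simp
  qed
  also have "\<dots> = (\<Sum>e\<in>B. 2 * g (\<phi> e) (\<phi> e))"
    using orthonormal_sum_square[OF on fin ker BT(3)] by (simp flip: sum_distrib_left)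
  also have "\<dots> = (\<Sum>e\<in>B. 2)"
    using BT by (intro sum.cong) (auto simp: structure_eqs(5))
  finally have "(\<Sum>e\<in>B. \<Sum>e'\<in>B. ?N e e') = 2 * real n"
    using card by simp
  moreover have "lee_theta M nabla p \<xi> = - (\<Sum>e\<in>B. nabla_eta e (\<phi> e))"
    unfolding lee_theta_def B_def[symmetric] sum_negf[symmetric]
    using BT by (intro sum.cong) (auto simp: fund_tensor_xi)
  ultimately show ?thesis
    using expand by simp
qed

end


section \<open>The classification\<close>

theorem theorem4p4:
  fixes M :: "('a, 'e::euclidean_space) apcr"
    and nabla :: "('a, 'e) connection"
    and n :: nat
  assumes "n \<ge> 1"
    and "paracontact_almost_paracomplex_riemannian n M"
    and "levi_civita_connection (mtop M) (atlas M) (metric M) nabla"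
  shows "(\<exists>I \<subseteq> {1, 2, 3, 7, 8, 10}. in_F4'_sum I M nabla n) \<and>
    (\<forall>p\<in>points M. \<forall>x\<in>tspace M p. \<forall>y\<in>tspace M p. \<forall>z\<in>tspace M p.
       fund_tensor M nabla p x y z =
         F1 M nabla n p x y z + F2 M nabla n p x y z + F3 M nabla n p x y z
         + F4' M nabla n p x y z + F7 M nabla n p x y z + F8 M nabla n p x y z
         + F10 M nabla n p x y z \<and>
       F4' M nabla n p x y z =
         - metric M p (phi M p x) (phi M p y) * eta M p z
         - metric M p (phi M p x) (phi M p z) * eta M p y)"
proof -
  have loc: "paracontact_at_point M nabla n p" if "p \<in> points M" for p
    using assms(2,3) that
    by unfold_locales (simp_all add: paracontact_almost_paracomplex_riemannian_def)
  have decomp: "fund_tensor M nabla p x y z =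
         F1 M nabla n p x y z + F2 M nabla n p x y z + F3 M nabla n p x y z
         + F4' M nabla n p x y z + F7 M nabla n p x y z + F8 M nabla n p x y z
         + F10 M nabla n p x y z"
    if "p \<in> points M" "x \<in> tspace M p" "y \<in> tspace M p" "z \<in> tspace M p" for p x y z
  proof -
    interpret paracontact_at_point M nabla n p by (rule loc[OF that(1)])
    show ?thesis
      using fund_tensor_decomposition[OF that(2-4)] horizontal_components[of x y z]
        mixed_components[OF assms(1) that(2-4)] by (simp add: F10_def)
  qed
  have theta: "lee_theta M nabla p (xi M p) = - 2 * real n" if "p \<in> points M" for p
    by (rule paracontact_at_point.lee_theta_xi[OF loc[OF that] assms(1)])
  have "F4 M nabla n p x y z = F4' M nabla n p x y z" if "p \<in> points M" for p x y z
    using theta[OF that] by (simp add: F4_def F4'_def)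
  then have "in_F4'_sum {1, 2, 3, 7, 8, 10} M nabla n"
    using decomp theta by (simp add: in_F4'_sum_def in_class_sum_def F_comp_def)
  moreover have "F4' M nabla n p x y z =
         - metric M p (phi M p x) (phi M p y) * eta M p z
         - metric M p (phi M p x) (phi M p z) * eta M p y" if "p \<in> points M" for p x y z
    by (rule paracontact_at_point.F4'_eq[OF loc[OF that] assms(1)])
  ultimately show ?thesis
    using decomp by blast
qed

end
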